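(* Consider the continuous-time system $\dot x(t)=A(t)x(t)+b(t)u(t)$, $y(t)=c(t)x(t)$, where $A(t)\in\mathbb{R}^{n\times n}$, $b(t)\in\mathbb{R}^{n\times1}$, $c(t)\in\mathbb{R}^{1\times n}$ have real-analytic entries in $t\in\mathbb{R}$. If the system is controllable and observable then, for a generic $c(t)$ and for all but countably many sampling periods $\delta>0$, the system is $\delta$-sample uniformly nullifiable by memoryless linear output feedback.
   Context: Controllability and observability are in the standard sense for linear time-varying continuous-time systems. "Generic" means: valid for an open and dense set of observation functions $c(\cdot)$ with respect to the supremum norm. Let $\Phi(t,s)$ be the fundamental (transition) matrix of $\dot x=A(t)x$. For $\delta>0$ and $t_k=k\delta$, the sampled-data system is the discrete-time system $x_{k+1}=A_\delta(k)x_k+b_\delta(k)u_k$, $y_k=c_\delta(k)x_k$ with $A_\delta(k)=\Phi(t_{k+1},t_k)$, $b_\delta(k)=\int_{t_k}^{t_{k+1}}\Phi(t_{k+1},s)b(s)\,ds$, $c_\delta(k)=c(t_k)$. A discrete-time system $(A_k,b_k,c_k)_{k\in\mathbb{Z}}$ is uniformly nullifiable by memoryless linear output feedback if there exist scalars $\{F_k\}_{k\in\mathbb{Z}}$ and $N\in\mathbb{N}$ such that for every $k\in\mathbb{Z}$ and every $x_k\in\mathbb{R}^n$, the dynamics $x_{j+1}=(A_j+F_jb_jc_j)x_j$ give $x_{k+N}=0$. The continuous system is $\delta$-sample uniformly nullifiable by memoryless linear output feedback if its sampled-data system with period $\delta$ is uniformly nullifiable by memoryless linear output feedback. *)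

theory Defs
  imports "HOL-Analysis.Analysis"
begin

definition real_analytic :: "(real \<Rightarrow> real) \<Rightarrow> bool" where
  "real_analytic f \<longleftrightarrow> (\<forall>t0. \<exists>r>0. \<exists>a::nat \<Rightarrow> real.
     \<forall>t. \<bar>t - t0\<bar> < r \<longrightarrow> (\<lambda>k. a k * (t - t0) ^ k) sums f t)"

definition analytic_mat :: "(real \<Rightarrow> real^'n^'m) \<Rightarrow> bool" where
  "analytic_mat A \<longleftrightarrow> (\<forall>i j. real_analytic (\<lambda>t. A t $ i $ j))"

definition analytic_vec :: "(real \<Rightarrow> real^'n) \<Rightarrow> bool" where
  "analytic_vec b \<longleftrightarrow> (\<forall>i. real_analytic (\<lambda>t. b t $ i))"

definition transition_matrix :: "(real \<Rightarrow> real^'n^'n) \<Rightarrow> (real \<Rightarrow> real \<Rightarrow> real^'n^'n) \<Rightarrow> bool" where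
  "transition_matrix A \<Phi> \<longleftrightarrow> (\<forall>s. \<Phi> s s = mat 1 \<and>
     (\<forall>t. ((\<lambda>\<tau>. \<Phi> \<tau> s) has_vector_derivative (A t ** \<Phi> t s)) (at t)))"

text \<open>Controllability on [t0,t1]: every state x0 at t0 can be steered to every x1 at t1;
  by variation of constants x(t1) = \<Phi>(t1,t0) x0 + \<integral> \<Phi>(t1,s) b(s) u(s) ds.\<close>
definition controllable_on ::
  "(real \<Rightarrow> real \<Rightarrow> real^'n^'n) \<Rightarrow> (real \<Rightarrow> real^'n) \<Rightarrow> real \<Rightarrow> real \<Rightarrow> bool" where
  "controllable_on \<Phi> b t0 t1 \<longleftrightarrow> (\<forall>x0 x1. \<exists>u :: real \<Rightarrow> real.
     ((\<lambda>s. u s *\<^sub>R (\<Phi> t1 s *v b s)) has_integral (x1 - \<Phi> t1 t0 *v x0)) {t0..t1})"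

definition controllable ::
  "(real \<Rightarrow> real \<Rightarrow> real^'n^'n) \<Rightarrow> (real \<Rightarrow> real^'n) \<Rightarrow> bool" where
  "controllable \<Phi> b \<longleftrightarrow> (\<forall>t0. \<exists>t1>t0. controllable_on \<Phi> b t0 t1)"

definition observable_on ::
  "(real \<Rightarrow> real \<Rightarrow> real^'n^'n) \<Rightarrow> (real \<Rightarrow> real^'n) \<Rightarrow> real \<Rightarrow> real \<Rightarrow> bool" where
  "observable_on \<Phi> c t0 t1 \<longleftrightarrow> (\<forall>x0. (\<forall>t\<in>{t0..t1}. c t \<bullet> (\<Phi> t t0 *v x0) = 0) \<longrightarrow> x0 = 0)"

definition observable ::
  "(real \<Rightarrow> real \<Rightarrow> real^'n^'n) \<Rightarrow> (real \<Rightarrow> real^'n) \<Rightarrow> bool" where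
  "observable \<Phi> c \<longleftrightarrow> (\<forall>t0. \<exists>t1>t0. observable_on \<Phi> c t0 t1)"

definition samp_A :: "(real \<Rightarrow> real \<Rightarrow> real^'n^'n) \<Rightarrow> real \<Rightarrow> int \<Rightarrow> real^'n^'n" where
  "samp_A \<Phi> \<delta> k = \<Phi> (of_int (k+1) * \<delta>) (of_int k * \<delta>)"

definition samp_b :: "(real \<Rightarrow> real \<Rightarrow> real^'n^'n) \<Rightarrow> (real \<Rightarrow> real^'n) \<Rightarrow> real \<Rightarrow> int \<Rightarrow> real^'n" where
  "samp_b \<Phi> b \<delta> k = integral {of_int k * \<delta> .. of_int (k+1) * \<delta>}
      (\<lambda>s. \<Phi> (of_int (k+1) * \<delta>) s *v b s)"

definition samp_c :: "(real \<Rightarrow> real^'n) \<Rightarrow> real \<Rightarrow> int \<Rightarrow> real^'n" where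
  "samp_c c \<delta> k = c (of_int k * \<delta>)"

fun dt_traj :: "(int \<Rightarrow> real^'n^'n) \<Rightarrow> (int \<Rightarrow> real^'n) \<Rightarrow> (int \<Rightarrow> real^'n) \<Rightarrow> (int \<Rightarrow> real)
     \<Rightarrow> int \<Rightarrow> nat \<Rightarrow> real^'n \<Rightarrow> real^'n" where
  "dt_traj Ad bd cd F k 0 x = x"
| "dt_traj Ad bd cd F k (Suc m) x =
     (let z = dt_traj Ad bd cd F k m x; j = k + int m
      in Ad j *v z + (F j * (cd j \<bullet> z)) *\<^sub>R bd j)"

definition unif_nullifiable ::
  "(int \<Rightarrow> real^'n^'n) \<Rightarrow> (int \<Rightarrow> real^'n) \<Rightarrow> (int \<Rightarrow> real^'n) \<Rightarrow> bool" where
  "unif_nullifiable Ad bd cd \<longleftrightarrow> (\<exists>F :: int \<Rightarrow> real. \<exists>N :: nat.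
      \<forall>k x. dt_traj Ad bd cd F k N x = 0)"

definition sample_nullifiable ::
  "(real \<Rightarrow> real \<Rightarrow> real^'n^'n) \<Rightarrow> (real \<Rightarrow> real^'n) \<Rightarrow> (real \<Rightarrow> real^'n) \<Rightarrow> real \<Rightarrow> bool" where
  "sample_nullifiable \<Phi> b c \<delta> \<longleftrightarrow>
     unif_nullifiable (samp_A \<Phi> \<delta>) (samp_b \<Phi> b \<delta>) (samp_c c \<delta>)"

text \<open>Genericity w.r.t. the supremum norm, inside the space of real-analytic observation functions.\<close>
definition sup_open :: "(real \<Rightarrow> real^'n) set \<Rightarrow> bool" where
  "sup_open S \<longleftrightarrow> (\<forall>c\<in>S. \<exists>\<epsilon>>0. \<forall>c'. analytic_vec c' \<and> (\<forall>t. norm (c' t - c t) \<le> \<epsilon>) \<longrightarrow> c' \<in> S)"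

definition sup_dense :: "(real \<Rightarrow> real^'n) set \<Rightarrow> bool" where
  "sup_dense S \<longleftrightarrow> (\<forall>c. analytic_vec c \<longrightarrow> (\<forall>\<epsilon>>0. \<exists>c'\<in>S. \<forall>t. norm (c' t - c t) \<le> \<epsilon>))"

end

theory Submission
  imports Defs "HOL-Complex_Analysis.Cauchy_Integral_Formula"
begin

text \<open>
  In the coordinates \<open>z\<close> with \<open>x(t) = \<Phi>(t,0) z\<close> the drift disappears: a sampling step becomes
  \<open>z \<mapsto> z + F\<^sub>j (\<gamma>(j\<delta>) \<bullet> z) (B((j+1)\<delta>) - B(j\<delta>))\<close> with \<open>\<gamma>(t) = \<Phi>(t,0)\<^sup>T c(t)\<close> and
  \<open>B'(s) = \<beta>(s) = \<Phi>(0,s) b(s)\<close>, all of them real analytic. Take as generic the \<open>c\<close> for which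
  \<open>\<gamma> \<bullet> \<beta> = c \<bullet> b\<close> is not identically zero. A block of \<open>3K\<close> consecutive steps can drive any given state
  to zero as soon as all products of outputs and inputs in the block are nonzero and the outputs
  of the first third and the inputs of each other third span the space; \<open>n\<close> such blocks in succession
  annihilate a basis. For fixed \<open>m\<close>, these conditions on block \<open>m\<close> say that finitely many analytic
  functions of \<open>\<delta>\<close> do not vanish, so they fail for at most countably many \<open>\<delta>\<close> once they hold for
  a single one. If \<open>\<bar>m\<bar>\<close> is large, a suitable \<open>\<delta>\<close> squeezes the whole block near a point \<open>\<tau>\<close> with
  \<open>\<gamma>(\<tau>) \<bullet> \<beta>(\<tau>) \<noteq> 0\<close>; there, the conditions follow from continuity and from Rolle's theorem, since by
  controllability and observability the derivatives of \<open>\<beta>\<close> and of \<open>\<gamma>\<close> at \<open>\<tau>\<close> span the space. The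
  finitely many remaining blocks only enlarge the nullification time.
\<close>

section \<open>Discrete-time output feedback\<close>

lemma dt_traj_add:
  "dt_traj Ad bd cd F k (m + p) x = dt_traj Ad bd cd F (k + int m) p (dt_traj Ad bd cd F k m x)"
  by (induction p) (simp_all add: Let_def algebra_simps)

lemma linear_dt_traj: "linear (dt_traj Ad bd cd F k m)"
proof (induction m)
  case 0
  show ?case by (simp add: linear_iff)
next
  case (Suc m)
  interpret linear "dt_traj Ad bd cd F k m" by (rule Suc)
  show ?case
    by (simp add: linear_iff Let_def add scale inner_add_right algebra_simps
        matrix_vector_mult_scaleR)
qed

lemma dt_traj_zero: "dt_traj Ad bd cd F k m 0 = 0"
  using linear_0[OF linear_dt_traj] .

lemma dt_traj_cong:
  assumes "\<And>j. k \<le> j \<Longrightarrow> j < k + int m \<Longrightarrow> F j = G j"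
  shows "dt_traj Ad bd cd F k m x = dt_traj Ad bd cd G k m x"
  using assms by (induction m) (auto simp: Let_def)

text \<open>The scalar output is the same number in both coordinate systems, so the same gains
  \<open>F\<close> serve in both, and \<open>T j\<close>, \<open>T (j+1)\<close> intertwine the two
  steps at time \<open>j\<close>.\<close>

lemma dt_traj_change_coordinates:
  assumes "\<And>j. Ad j ** T j = T (j+1) ** Ad' j"
    and "\<And>j. bd j = T (j+1) *v bd' j"
    and "\<And>j. cd' j = transpose (T j) *v cd j"
  shows "dt_traj Ad bd cd F k m (T k *v x) = T (k + int m) *v dt_traj Ad' bd' cd' F k m x"
proof (induction m)
  case (Suc m)
  have "cd j \<bullet> (T j *v y) = cd' j \<bullet> y" for j y
    by (simp add: assms(3) dot_lmul_matrix[symmetric] flip: transpose_matrix_vector)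
  moreover have "Ad j *v (T j *v y) = T (j+1) *v (Ad' j *v y)" for j y
    by (simp add: matrix_vector_mul_assoc assms(1))
  ultimately show ?case
    using Suc by (simp add: Let_def assms(2) matrix_vector_right_distrib matrix_vector_mult_scaleR
        add_ac)
qed simp

lemma unif_nullifiable_change_coordinates:
  assumes "\<And>j. Ad j ** T j = T (j+1) ** Ad' j"
    and "\<And>j. bd j = T (j+1) *v bd' j"
    and "\<And>j. cd' j = transpose (T j) *v cd j"
    and "\<And>j. invertible (T j)"
    and "unif_nullifiable Ad' bd' cd'"
  shows "unif_nullifiable Ad bd cd"
proof -
  obtain F N where F: "\<forall>k x. dt_traj Ad' bd' cd' F k N x = 0"
    using assms(5) unfolding unif_nullifiable_def by iprover
  have "dt_traj Ad bd cd F k N x = 0" for k x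
  proof -
    obtain B where "T k ** B = mat 1"
      using assms(4)[of k] unfolding invertible_def by auto
    then have "x = T k *v (B *v x)"
      by (simp add: matrix_vector_mul_assoc)
    then have "dt_traj Ad bd cd F k N x = T (k + int N) *v dt_traj Ad' bd' cd' F k N (B *v x)"
      using dt_traj_change_coordinates[of Ad T Ad' bd bd' cd' cd F k N "B *v x", OF assms(1-3)]
      by simp
    then show ?thesis
      using F by simp
  qed
  then show ?thesis
    by (auto simp: unif_nullifiable_def)
qed

section \<open>Steering a single state to zero\<close>

text \<open>\<open>W\<close> is a linear space, each condition fails only on an affine hyperplane of
  it, and finitely many hyperplanes do not cover \<open>W\<close>. In the induction a point good for
  \<open>I\<close> is moved along a direction \<open>v\<close> with \<open>\<phi> i v\<close>
  nonzero; every condition then rules out at most one parameter \<open>t\<close>.\<close>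

lemma exists_avoiding_zeros:
  fixes \<phi> :: "'i \<Rightarrow> ('a \<Rightarrow> real) \<Rightarrow> real"
  assumes "finite I"
    and W0: "(\<lambda>_. 0) \<in> W"
    and W: "\<And>w w' t. w \<in> W \<Longrightarrow> w' \<in> W \<Longrightarrow> (\<lambda>l. w l + t * w' l) \<in> W"
    and \<phi>: "\<And>i w w' t. i \<in> I \<Longrightarrow> \<phi> i (\<lambda>l. w l + t * w' l) = \<phi> i w + t * \<phi> i w'"
    and ex: "\<And>i. i \<in> I \<Longrightarrow> \<exists>w\<in>W. \<phi> i w \<noteq> 0"
  shows "\<exists>w\<in>W. \<forall>i\<in>I. \<alpha> i + \<phi> i w \<noteq> 0"
  using assms(1) \<phi> ex
proof (induction I)
  case empty
  then show ?case using W0 by blast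
next
  case (insert i I)
  have "\<exists>w\<in>W. \<forall>k\<in>I. \<alpha> k + \<phi> k w \<noteq> 0"
    by (rule insert.IH; rule insert.prems; rule insertI2)
  then obtain w where w: "w \<in> W" "\<forall>k\<in>I. \<alpha> k + \<phi> k w \<noteq> 0" ..
  obtain v where v: "v \<in> W" "\<phi> i v \<noteq> 0"
    using insert.prems(2)[OF insertI1] ..
  \<comment> \<open>The quotient is the only bad parameter for condition \<open>k\<close> if
    \<open>\<phi> k v\<close> is nonzero; otherwise division by zero merely adds the harmless value
    0.\<close>
  have "finite ((\<lambda>k. - (\<alpha> k + \<phi> k w) / \<phi> k v) ` insert i I)"
    using insert.hyps by blast
  then obtain t where t: "t \<notin> (\<lambda>k. - (\<alpha> k + \<phi> k w) / \<phi> k v) ` insert i I"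
    using ex_new_if_finite infinite_UNIV_char_0 by blast
  have *: "\<alpha> k + \<phi> k (\<lambda>l. w l + t * v l) \<noteq> 0" if k: "k \<in> insert i I" for k
  proof (cases "\<phi> k v = 0")
    case True
    then have "k \<in> I"
      using k v by auto
    then show ?thesis
      using w True by (simp only: insert.prems(1)[OF k]) simp
  next
    case False
    have "t \<noteq> - (\<alpha> k + \<phi> k w) / \<phi> k v"
      using t k by blast
    then have "\<alpha> k + \<phi> k w + t * \<phi> k v \<noteq> 0"
      using False by (simp add: eq_divide_eq)
    then show ?thesis
      by (simp only: insert.prems(1)[OF k] add.assoc) simp
  qed
  show ?case
    by (rule bexI[OF _ W[OF w(1) v(1), of t]], rule ballI, rule *)
qed

text \<open>Vectors with trivial orthogonal complement span. Coefficients are indexed by the whole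
  range \<open>{..<R}\<close> and vanish off \<open>I\<close>, so that inputs supported on different
  parts of a block can be added.\<close>

lemma exists_combination:
  fixes b :: "nat \<Rightarrow> 'a::euclidean_space"
  assumes span: "\<And>x. (\<forall>l\<in>I. x \<bullet> b l = 0) \<Longrightarrow> x = 0" and I: "I \<subseteq> {..<R}"
  shows "\<exists>w. (\<forall>l. l \<notin> I \<longrightarrow> w l = 0) \<and> (\<Sum>l<R. w l *\<^sub>R b l) = v"
proof -
  let ?C = "{v. \<exists>w. (\<forall>l. l \<notin> I \<longrightarrow> w l = 0) \<and> (\<Sum>l<R. w l *\<^sub>R b l) = v}"
  have "subspace ?C"
    unfolding subspace_def
  proof (intro conjI ballI allI)
    show "0 \<in> ?C" by (auto intro!: exI[of _ "\<lambda>_. 0"])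
  next
    fix x y assume "x \<in> ?C" "y \<in> ?C"
    then obtain w w' where "\<forall>l. l \<notin> I \<longrightarrow> w l = 0" "(\<Sum>l<R. w l *\<^sub>R b l) = x"
      "\<forall>l. l \<notin> I \<longrightarrow> w' l = 0" "(\<Sum>l<R. w' l *\<^sub>R b l) = y" by blast
    then show "x + y \<in> ?C"
      by (auto intro!: exI[of _ "\<lambda>l. w l + w' l"] simp: algebra_simps sum.distrib)
  next
    fix c :: real and x assume "x \<in> ?C"
    then obtain w where "\<forall>l. l \<notin> I \<longrightarrow> w l = 0" "(\<Sum>l<R. w l *\<^sub>R b l) = x" by blast
    then show "c *\<^sub>R x \<in> ?C"
      by (auto intro!: exI[of _ "\<lambda>l. c * w l"] simp: scaleR_sum_right)
  qed
  moreover have "b ` I \<subseteq> ?C"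
  proof
    fix x assume "x \<in> b ` I"
    then obtain j where j: "j \<in> I" "x = b j" by blast
    have "(\<Sum>l<R. (if l = j then 1 else 0) *\<^sub>R b l) = (\<Sum>l<R. if l = j then b l else 0)"
      by (intro sum.cong) auto
    also have "\<dots> = b j"
      using j I by (simp add: subset_eq)
    finally show "x \<in> ?C"
      using j by (auto intro!: exI[of _ "\<lambda>l. if l = j then 1 else 0"])
  qed
  ultimately have "span (b ` I) \<subseteq> ?C"
    by (rule span_minimal[rotated])
  moreover have "span (b ` I) = UNIV"
  proof (rule ccontr)
    assume "span (b ` I) \<noteq> UNIV"
    then obtain a where "a \<noteq> 0" "span (b ` I) \<subseteq> {x. a \<bullet> x = 0}"
      using span_not_univ_subset_hyperplane by blast
    then show False
      using span[of a] span_superset[of "b ` I"] by auto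
  qed
  ultimately show ?thesis by blast
qed

text \<open>The inputs \<^term>\<open>u\<close> annihilating \<^term>\<open>z\<close> form an affine space. An input acts as an output
  feedback as soon as every output seen along the way is nonzero, and this excludes only finitely
  many proper affine subspaces.\<close>
lemma drift_free_steer:
  fixes \<beta> \<gamma> :: "int \<Rightarrow> real^'n"
  assumes nz: "\<And>i j. i < 3*K \<Longrightarrow> j < 3*K \<Longrightarrow> \<gamma> (k + int i) \<bullet> \<beta> (k + int j) \<noteq> 0"
    and obs: "\<And>x. (\<forall>l\<in>{0..<K}. x \<bullet> \<gamma> (k + int l) = 0) \<Longrightarrow> x = 0"
    and ctr1: "\<And>x. (\<forall>l\<in>{K..<2*K}. x \<bullet> \<beta> (k + int l) = 0) \<Longrightarrow> x = 0"
    and ctr2: "\<And>x. (\<forall>l\<in>{2*K..<3*K}. x \<bullet> \<beta> (k + int l) = 0) \<Longrightarrow> x = 0"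
  shows "\<exists>F. dt_traj (\<lambda>_. mat 1) \<beta> \<gamma> F k (3*K) z = 0"
proof (cases "z = 0")
  case True
  then show ?thesis by (simp add: dt_traj_zero)
next
  case False
  define b where "b l = \<beta> (k + int l)" for l
  define g where "g l = \<gamma> (k + int l)" for l
  \<comment> \<open>A time in the first third at which \<open>z\<close> is visible: the state can
    rest at \<open>z\<close> until \<open>i0\<close>, and a nonzero input is possible there.\<close>
  obtain i0 where i0: "i0 < K" "g i0 \<bullet> z \<noteq> 0"
    using obs[of z] False unfolding g_def by (metis atLeastLessThan_iff inner_commute)
  \<comment> \<open>The times at which a nonzero input is permitted; \<open>W\<close> collects the
    permitted inputs with no net effect, and \<open>u0\<close> is one permitted input that cancels
    \<open>z\<close>.\<close>
  define J where "J = insert i0 {K..<3*K}"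
  define W where "W = {w. (\<forall>l. l \<notin> J \<longrightarrow> w l = 0) \<and> (\<Sum>l<3*K. w l *\<^sub>R b l) = 0}"
  obtain u0 where u0: "\<forall>l. l \<notin> {K..<2*K} \<longrightarrow> u0 l = 0" "(\<Sum>l<3*K. u0 l *\<^sub>R b l) = - z"
    using exists_combination[of "{K..<2*K}" b "3*K" "- z"] ctr1 unfolding b_def by force
  have sum_add: "(\<Sum>l\<in>S. (w l + t * w' l) *\<^sub>R b l) = (\<Sum>l\<in>S. w l *\<^sub>R b l) + t *\<^sub>R (\<Sum>l\<in>S. w' l *\<^sub>R b l)"
    for S :: "nat set" and w w' t
    by (simp add: algebra_simps sum.distrib scaleR_sum_right)
  have ex: "\<exists>w\<in>W. g i \<bullet> (\<Sum>l<i. w l *\<^sub>R b l) \<noteq> 0" if i: "i \<in> {K..<3*K}" for i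
  proof (cases "i < 2*K")
    case True
    \<comment> \<open>A unit input at \<open>i0\<close> is compensated in the last third, so just
      before a time \<open>i\<close> of the middle third the displacement is exactly
      \<open>b i0\<close>, which \<open>g i\<close> sees.\<close>
    obtain w where w: "\<forall>l. l \<notin> {2*K..<3*K} \<longrightarrow> w l = 0" "(\<Sum>l<3*K. w l *\<^sub>R b l) = - b i0"
      using exists_combination[of "{2*K..<3*K}" b "3*K" "- b i0"] ctr2 unfolding b_def by force
    \<comment> \<open>The factor 1 gives the sum the shape of \<open>sum_add\<close>.\<close>
    define w' where "w' l = w l + 1 * (if l = i0 then 1 else 0)" for l
    have e: "(\<Sum>l<j. (if l = i0 then 1 else 0) *\<^sub>R b l) = b i0" if "i0 < j" for j
    proof -
      have "(\<Sum>l<j. (if l = i0 then 1 else 0) *\<^sub>R b l) = (\<Sum>l<j. if l = i0 then b l else 0)"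
        by (intro sum.cong) auto
      then show ?thesis using that by simp
    qed
    have "(\<Sum>l<3*K. w' l *\<^sub>R b l) = 0"
      unfolding w'_def sum_add using w e[of "3*K"] i0 by simp
    then have "w' \<in> W"
      using w i0 by (auto simp: W_def J_def w'_def)
    moreover have "(\<Sum>l<i. w l *\<^sub>R b l) = 0"
      using w True by (intro sum.neutral) auto
    then have "(\<Sum>l<i. w' l *\<^sub>R b l) = b i0"
      unfolding w'_def sum_add using e[of i] i0 i by simp
    moreover have "g i \<bullet> b i0 \<noteq> 0"
      using nz[of i i0] i i0 by (simp add: g_def b_def)
    ultimately show ?thesis by (metis (no_types, lifting))
  next
    case False
    \<comment> \<open>For \<open>i\<close> in the last third a unit input at \<open>i\<close> itself
      is compensated beforehand, in the middle third; just before \<open>i\<close> the displacement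
      is \<open>- b i\<close>.\<close>
    obtain w where w: "\<forall>l. l \<notin> {K..<2*K} \<longrightarrow> w l = 0" "(\<Sum>l<3*K. w l *\<^sub>R b l) = - b i"
      using exists_combination[of "{K..<2*K}" b "3*K" "- b i"] ctr1 unfolding b_def by force
    define w' where "w' l = w l + 1 * (if l = i then 1 else 0)" for l
    have "(\<Sum>l<3*K. (if l = i then 1 else 0) *\<^sub>R b l) = (\<Sum>l<3*K. if l = i then b l else 0)"
      by (intro sum.cong) auto
    then have "(\<Sum>l<3*K. w' l *\<^sub>R b l) = 0"
      unfolding w'_def sum_add using w i by simp
    then have "w' \<in> W"
      using w i by (auto simp: W_def J_def w'_def)
    moreover have "(\<Sum>l<i. w' l *\<^sub>R b l) = (\<Sum>l<3*K. w l *\<^sub>R b l)"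
      unfolding w'_def using w i False by (intro sum.mono_neutral_cong_left) auto
    then have "(\<Sum>l<i. w' l *\<^sub>R b l) = - b i"
      using w by simp
    moreover have "g i \<bullet> b i \<noteq> 0"
      using nz[of i i] i by (simp add: g_def b_def)
    ultimately show ?thesis by (metis (no_types, lifting) inner_minus_right neg_equal_0_iff_equal)
  qed
  have "\<exists>w\<in>W. \<forall>i\<in>{K..<3*K}. g i \<bullet> (z + (\<Sum>l<i. u0 l *\<^sub>R b l)) + g i \<bullet> (\<Sum>l<i. w l *\<^sub>R b l) \<noteq> 0"
  proof (rule exists_avoiding_zeros)
    show "(\<lambda>l. w l + t * w' l) \<in> W" if "w \<in> W" "w' \<in> W" for w w' t
      using that unfolding W_def by (simp add: sum_add)
  qed (use ex in \<open>auto simp: W_def sum_add inner_add_right\<close>)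
  then obtain w where w: "w \<in> W"
    "\<And>i. i \<in> {K..<3*K} \<Longrightarrow> g i \<bullet> (z + (\<Sum>l<i. u0 l *\<^sub>R b l)) + g i \<bullet> (\<Sum>l<i. w l *\<^sub>R b l) \<noteq> 0"
    by blast
  define u where "u l = u0 l + 1 * w l" for l
  define y where "y i = z + (\<Sum>l<i. u l *\<^sub>R b l)" for i
  \<comment> \<open>Gain = input / output. Off \<open>J\<close> the input is 0, hence so is the
    gain; on \<open>J\<close> the output is nonzero.\<close>
  define F where "F j = u (nat (j - k)) / (g (nat (j - k)) \<bullet> y (nat (j - k)))" for j
  have uJ: "u l = 0" if "l \<notin> J" for l
    using that w(1) u0(1) by (auto simp: u_def W_def J_def)
  have "y i0 = z"
    unfolding y_def using uJ i0 by (auto simp: J_def intro!: sum.neutral)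
  have gy: "g i \<bullet> y i \<noteq> 0" if "i \<in> J" for i
  proof (cases "i = i0")
    case True
    then show ?thesis using i0 \<open>y i0 = z\<close> by simp
  next
    case False
    then show ?thesis
      using that w(2)[of i] unfolding J_def y_def u_def sum_add
      by (simp add: inner_add_right add_ac)
  qed
  have "dt_traj (\<lambda>_. mat 1) \<beta> \<gamma> F k i z = y i" for i
  proof (induction i)
    case 0
    show ?case by (simp add: y_def)
  next
    case (Suc i)
    have "F (k + int i) * (\<gamma> (k + int i) \<bullet> y i) = u i"
      using gy[of i] uJ[of i] by (cases "i \<in> J") (auto simp: F_def g_def)
    then show ?case
      using Suc by (simp add: Let_def) (simp add: y_def b_def)
  qed
  moreover have "y (3*K) = 0"
    using u0(2) w(1) unfolding y_def u_def sum_add by (simp add: W_def)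
  ultimately show ?thesis by (intro exI[of _ F]) simp
qed

section \<open>From single states to uniform nullification\<close>

text \<open>States are killed one per block: the block reserved for \<open>x\<close> is designed for
  the state into which the earlier blocks have carried \<open>x\<close>. States killed before stay
  at 0, a fixed point under every feedback.\<close>

lemma dt_traj_kill_finite:
  assumes "finite S"
    and "\<And>p z. p < card S \<Longrightarrow> \<exists>F. dt_traj Ad bd cd F (k + int (P * p)) P z = 0"
  shows "\<exists>F. \<forall>z\<in>S. dt_traj Ad bd cd F k (P * card S) z = 0"
  using assms
proof (induction S)
  case (insert x S)
  let ?k = "k + int (P * card S)"
  obtain F1 where F1: "\<forall>z\<in>S. dt_traj Ad bd cd F1 k (P * card S) z = 0"
    using insert.IH[OF insert.prems] insert.hyps by auto
  obtain F2 where F2: "dt_traj Ad bd cd F2 ?k P (dt_traj Ad bd cd F1 k (P * card S) x) = 0"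
    using insert.prems[of "card S"] insert.hyps by auto
  define F where "F j = (if j < ?k then F1 j else F2 j)" for j
  have 1: "dt_traj Ad bd cd F k (P * card S) z = dt_traj Ad bd cd F1 k (P * card S) z" for z
    by (rule dt_traj_cong) (simp add: F_def)
  have 2: "dt_traj Ad bd cd F ?k P z = dt_traj Ad bd cd F2 ?k P z" for z
    by (rule dt_traj_cong) (simp add: F_def)
  have "P * card (insert x S) = P * card S + P"
    using insert.hyps by simp
  then have "dt_traj Ad bd cd F k (P * card (insert x S)) z
      = dt_traj Ad bd cd F2 ?k P (dt_traj Ad bd cd F1 k (P * card S) z)" for z
    by (simp only: dt_traj_add 1 2)
  then show ?case
    using F1 F2 by (intro exI[of _ F]) (auto simp: dt_traj_zero)
qed simp

lemma dt_traj_kill_all: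
  fixes Ad :: "int \<Rightarrow> real^'n^'n"
  assumes "\<And>p z. p < CARD('n) \<Longrightarrow> \<exists>F. dt_traj Ad bd cd F (k + int (P * p)) P z = 0"
  shows "\<exists>F. \<forall>z. dt_traj Ad bd cd F k (P * CARD('n)) z = 0"
proof -
  have "card (Basis :: (real^'n) set) = CARD('n)"
    by simp
  then obtain F where F: "\<forall>z\<in>Basis. dt_traj Ad bd cd F k (P * CARD('n)) z = 0"
    using dt_traj_kill_finite[of Basis Ad bd cd k P] assms by auto
  have "dt_traj Ad bd cd F k (P * CARD('n)) = (\<lambda>z. 0)"
    by (rule linear_eq_stdbasis[OF linear_dt_traj linear_zero]) (use F in blast)
  then show ?thesis by (intro exI[of _ F]) simp
qed

text \<open>It suffices that every time window of a fixed length \<open>N\<close> contains one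
  complete nullifying block: before it the state is arbitrary, after it the state remains 0.\<close>

lemma unif_nullifiable_blocks:
  fixes M :: nat
  assumes "L > 0"
    and blocks: "\<And>q. q \<ge> int M \<or> q < - int M \<Longrightarrow> \<exists>F. \<forall>x. dt_traj Ad bd cd F (int L * q) L x = 0"
  shows "unif_nullifiable Ad bd cd"
proof -
  obtain G where G: "\<And>q x. q \<ge> int M \<or> q < - int M \<Longrightarrow> dt_traj Ad bd cd (G q) (int L * q) L x = 0"
    using blocks by metis
  \<comment> \<open>Floor division finds the block of \<open>j\<close>, for negative
    \<open>j\<close> as well; in the exceptional blocks the gains are arbitrary.\<close>
  define F where "F j = G (j div int L) j" for j
  have blk: "dt_traj Ad bd cd F (int L * q) L x = 0" if "q \<ge> int M \<or> q < - int M" for q x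
  proof -
    have "j div int L = q" if "int L * q \<le> j" "j < int L * q + int L" for j
      using that int_div_pos_eq[of j "int L" q "j - int L * q"] by auto
    then have "dt_traj Ad bd cd F (int L * q) L x = dt_traj Ad bd cd (G q) (int L * q) L x"
      by (intro dt_traj_cong) (simp add: F_def)
    then show ?thesis using G[OF that] by simp
  qed
  \<comment> \<open>The exceptional blocks are those from \<open>-M\<close> to \<open>M - 1\<close>,
    which makes \<open>2 * M\<close>; one more block length pays for reaching a block boundary and
    one for the nullifying block.\<close>
  define N where "N = L * (2 * M + 2)"
  have "dt_traj Ad bd cd F k N x = 0" for k x
  proof -
    \<comment> \<open>Ceiling of \<open>k / L\<close>: the first block that starts at or after
      \<open>k\<close>. If it is exceptional, block \<open>M\<close> is taken instead.\<close>
    define q0 where "q0 = (k + int L - 1) div int L"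
    have q0: "k \<le> int L * q0" "int L * q0 < k + int L"
      using \<open>L > 0\<close> unfolding q0_def
      by (smt (verit) of_nat_0_less_iff pos_mod_bound pos_mod_sign mult_div_mod_eq)+
    obtain q where q: "q \<ge> int M \<or> q < - int M" "k \<le> int L * q" "int L * q + int L \<le> k + int N"
    proof (cases "q0 \<ge> int M \<or> q0 < - int M")
      case True
      have "int N = int L * (2 * int M) + 2 * int L"
        by (simp add: N_def algebra_simps)
      moreover have "0 \<le> int L * (2 * int M)"
        by simp
      ultimately have "int L * q0 + int L \<le> k + int N"
        using q0 by linarith
      then show ?thesis using that True q0 by blast
    next
      case False
      have N: "int N = int L * int M + int L * int M + 2 * int L"
        by (simp add: N_def algebra_simps)
      have "int L * q0 \<le> int L * int M" "int L * (- int M) \<le> int L * q0"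
        using False by (intro mult_left_mono; simp)+
      then have "k \<le> int L * int M" "int L * int M + int L \<le> k + int N"
        using q0 N by linarith+
      then show ?thesis using that[of "int M"] by simp
    qed
    define d where "d = nat (int L * q - k)"
    define e where "e = N - d - L"
    have N: "N = d + (L + e)" and d: "k + int d = int L * q"
      using q by (auto simp: d_def e_def)
    show ?thesis
      unfolding N dt_traj_add d blk[OF q(1)] by (rule dt_traj_zero)
  qed
  then show ?thesis
    by (auto simp: unif_nullifiable_def)
qed

section \<open>Real analytic functions\<close>

text \<open>The real power series also converges at complex points: real convergence at distance
  \<open>s\<close>, with \<open>s\<close> strictly between the distance of \<open>w\<close> from the
  centre and \<open>r\<close>, forces convergence at \<open>w\<close>.\<close>

lemma real_analytic_holomorphic_extension:
  assumes "real_analytic f"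
  obtains r g where "r > 0" "g holomorphic_on ball (of_real t0) r"
    "\<And>t. \<bar>t - t0\<bar> < r \<Longrightarrow> g (of_real t) = complex_of_real (f t)"
proof -
  obtain r a where r: "r > 0"
    and a: "\<And>t. \<bar>t - t0\<bar> < r \<Longrightarrow> (\<lambda>k. a k * (t - t0) ^ k) sums f t"
    using assms unfolding real_analytic_def by blast
  define g where "g w = (\<Sum>k. complex_of_real (a k) * (w - of_real t0) ^ k)" for w
  have "(\<lambda>k. complex_of_real (a k) * (w - of_real t0) ^ k) sums g w" if w: "w \<in> ball (of_real t0) r" for w
  proof -
    define s where "s = (dist (of_real t0) w + r) / 2"
    have s: "dist (of_real t0) w < s" "s < r"
      using w by (auto simp: s_def)
    then have "\<bar>(t0 + s) - t0\<bar> < r"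
      using zero_le_dist[of "complex_of_real t0" w] by linarith
    then have "summable (\<lambda>k. a k * s ^ k)"
      using a[of "t0 + s"] by (simp add: sums_iff)
    then have "summable (\<lambda>k. complex_of_real (a k) * of_real s ^ k)"
      unfolding of_real_power[symmetric] of_real_mult[symmetric] by (simp only: summable_of_real)
    then have "summable (\<lambda>k. complex_of_real (a k) * (w - of_real t0) ^ k)"
      by (rule powser_inside) (use s in \<open>simp add: dist_norm norm_minus_commute\<close>)
    then show ?thesis
      by (simp add: g_def summable_sums)
  qed
  then have "g holomorphic_on ball (of_real t0) r"
    by (rule power_series_holomorphic)
  moreover have "g (of_real t) = complex_of_real (f t)" if "\<bar>t - t0\<bar> < r" for t
  proof -
    have "(\<lambda>k. complex_of_real (a k * (t - t0) ^ k)) sums of_real (f t)"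
      using a[OF that] by (simp only: sums_of_real_iff)
    then show ?thesis
      by (simp add: g_def sums_iff)
  qed
  ultimately show ?thesis
    using that r by blast
qed

text \<open>For real \<open>t\<close> the real part can be taken term by term in the Taylor series
  of \<open>g\<close>. Matching only \<open>Re g\<close> with \<open>f\<close> spares showing that
  \<open>g\<close> is real on the axis, which is convenient for primitives.\<close>

lemma real_analyticI_holomorphic:
  assumes "\<And>t0. \<exists>r>0. \<exists>g. g holomorphic_on ball (complex_of_real t0) r \<and>
    (\<forall>t. \<bar>t - t0\<bar> < r \<longrightarrow> Re (g (of_real t)) = f t)"
  shows "real_analytic f"
  unfolding real_analytic_def
proof
  fix t0
  obtain r g where r: "r > 0" and g: "g holomorphic_on ball (complex_of_real t0) r"
    and f: "\<And>t. \<bar>t - t0\<bar> < r \<Longrightarrow> Re (g (of_real t)) = f t"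
    using assms[of t0] by blast
  define a where "a k = Re ((deriv ^^ k) g (of_real t0) / fact k)" for k
  have "(\<lambda>k. a k * (t - t0) ^ k) sums f t" if t: "\<bar>t - t0\<bar> < r" for t
  proof -
    have "complex_of_real t \<in> ball (of_real t0) r"
      using t by (simp add: dist_real_def abs_minus_commute)
    then have "(\<lambda>k. (deriv ^^ k) g (of_real t0) / fact k * (of_real t - of_real t0) ^ k) sums g (of_real t)"
      by (rule holomorphic_power_series[OF g])
    then have "(\<lambda>k. Re ((deriv ^^ k) g (of_real t0) / fact k * (of_real t - of_real t0) ^ k)) sums Re (g (of_real t))"
      by (rule sums_Re)
    moreover have "Re (z * (complex_of_real t - of_real t0) ^ k) = Re z * (t - t0) ^ k" for z k
      unfolding of_real_diff[symmetric] of_real_power[symmetric] by simp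
    ultimately show ?thesis
      by (simp only: a_def f[OF t])
  qed
  then show "\<exists>r>0. \<exists>a. \<forall>t. \<bar>t - t0\<bar> < r \<longrightarrow> (\<lambda>k. a k * (t - t0) ^ k) sums f t"
    using r by blast
qed

lemma real_analytic_const [intro]: "real_analytic (\<lambda>_. c)"
  by (rule real_analyticI_holomorphic)
     (auto intro!: exI[of _ 1] exI[of _ "\<lambda>_. of_real c"] holomorphic_intros)

lemma real_analytic_add [intro]:
  assumes "real_analytic f" "real_analytic g"
  shows "real_analytic (\<lambda>t. f t + g t)"
proof (rule real_analyticI_holomorphic)
  fix t0
  obtain r1 F where F: "r1 > 0" "F holomorphic_on ball (of_real t0) r1"
    "\<And>t. \<bar>t - t0\<bar> < r1 \<Longrightarrow> F (of_real t) = complex_of_real (f t)"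
    using real_analytic_holomorphic_extension[OF assms(1)] by blast
  obtain r2 G where G: "r2 > 0" "G holomorphic_on ball (of_real t0) r2"
    "\<And>t. \<bar>t - t0\<bar> < r2 \<Longrightarrow> G (of_real t) = complex_of_real (g t)"
    using real_analytic_holomorphic_extension[OF assms(2)] by blast
  have "(\<lambda>z. F z + G z) holomorphic_on ball (of_real t0) (min r1 r2)"
    using F G by (intro holomorphic_intros; elim holomorphic_on_subset) auto
  then show "\<exists>r>0. \<exists>h. h holomorphic_on ball (complex_of_real t0) r \<and>
      (\<forall>t. \<bar>t - t0\<bar> < r \<longrightarrow> Re (h (of_real t)) = f t + g t)"
    using F G by (intro exI[of _ "min r1 r2"] conjI exI[of _ "\<lambda>z. F z + G z"]) auto
qed

lemma real_analytic_mult [intro]: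
  assumes "real_analytic f" "real_analytic g"
  shows "real_analytic (\<lambda>t. f t * g t)"
proof (rule real_analyticI_holomorphic)
  fix t0
  obtain r1 F where F: "r1 > 0" "F holomorphic_on ball (of_real t0) r1"
    "\<And>t. \<bar>t - t0\<bar> < r1 \<Longrightarrow> F (of_real t) = complex_of_real (f t)"
    using real_analytic_holomorphic_extension[OF assms(1)] by blast
  obtain r2 G where G: "r2 > 0" "G holomorphic_on ball (of_real t0) r2"
    "\<And>t. \<bar>t - t0\<bar> < r2 \<Longrightarrow> G (of_real t) = complex_of_real (g t)"
    using real_analytic_holomorphic_extension[OF assms(2)] by blast
  have "(\<lambda>z. F z * G z) holomorphic_on ball (of_real t0) (min r1 r2)"
    using F G by (intro holomorphic_intros; elim holomorphic_on_subset) auto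
  then show "\<exists>r>0. \<exists>h. h holomorphic_on ball (complex_of_real t0) r \<and>
      (\<forall>t. \<bar>t - t0\<bar> < r \<longrightarrow> Re (h (of_real t)) = f t * g t)"
    using F G by (intro exI[of _ "min r1 r2"] conjI exI[of _ "\<lambda>z. F z * G z"]) auto
qed

lemma real_analytic_inverse:
  assumes "real_analytic f" and nz: "\<And>t. f t \<noteq> 0"
  shows "real_analytic (\<lambda>t. inverse (f t))"
proof (rule real_analyticI_holomorphic)
  fix t0
  obtain r F where F: "r > 0" "F holomorphic_on ball (of_real t0) r"
    "\<And>t. \<bar>t - t0\<bar> < r \<Longrightarrow> F (of_real t) = complex_of_real (f t)"
    using real_analytic_holomorphic_extension[OF assms(1)] by blast
  have "continuous_on (ball (of_real t0) r) F" "F (of_real t0) \<noteq> 0"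
    using F nz by (auto intro: holomorphic_on_imp_continuous_on)
  \<comment> \<open>\<open>f\<close> has no real zeros, but its extension may have complex ones; the
    ball is shrunk to avoid them.\<close>
  then obtain e where e: "e > 0" "\<And>z. z \<in> ball (of_real t0) r \<Longrightarrow> dist (of_real t0) z < e \<Longrightarrow> F z \<noteq> 0"
    using continuous_on_avoid[of "ball (of_real t0) r" F "of_real t0" 0] F(1) by auto
  have "(\<lambda>z. inverse (F z)) holomorphic_on ball (of_real t0) (min r e)"
  proof (rule holomorphic_on_inverse)
    show "F holomorphic_on ball (of_real t0) (min r e)"
      using F(2) by (rule holomorphic_on_subset) auto
  qed (use e in auto)
  then show "\<exists>r>0. \<exists>h. h holomorphic_on ball (complex_of_real t0) r \<and>
      (\<forall>t. \<bar>t - t0\<bar> < r \<longrightarrow> Re (h (of_real t)) = inverse (f t))"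
    using F e by (intro exI[of _ "min r e"] conjI exI[of _ "\<lambda>z. inverse (F z)"])
      (auto simp flip: of_real_inverse)
qed

lemma real_analytic_sum [intro]:
  "(\<And>i. i \<in> I \<Longrightarrow> real_analytic (f i)) \<Longrightarrow> real_analytic (\<lambda>t. \<Sum>i\<in>I. f i t)"
  by (induction I rule: infinite_finite_induct) auto

lemma real_analytic_prod [intro]:
  "(\<And>i. i \<in> I \<Longrightarrow> real_analytic (f i)) \<Longrightarrow> real_analytic (\<lambda>t. \<Prod>i\<in>I. f i t)"
  by (induction I rule: infinite_finite_induct) auto

lemma real_analytic_diff [intro]:
  assumes "real_analytic f" "real_analytic g"
  shows "real_analytic (\<lambda>t. f t - g t)"
  using real_analytic_add[OF assms(1) real_analytic_mult[OF real_analytic_const[of "-1"] assms(2)]]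
  by simp

text \<open>Applied with \<open>s\<close> an integer time index and the sampling period as variable.
  The index 0 occurs, hence the radius \<open>r / (\<bar>s\<bar> + 1)\<close>.\<close>

lemma real_analytic_scale_argument:
  assumes "real_analytic f"
  shows "real_analytic (\<lambda>t. f (s * t))"
  unfolding real_analytic_def
proof
  fix t0
  obtain r a where r: "r > 0"
    and a: "\<And>t. \<bar>t - s * t0\<bar> < r \<Longrightarrow> (\<lambda>k. a k * (t - s * t0) ^ k) sums f t"
    using assms unfolding real_analytic_def by blast
  have "(\<lambda>k. (a k * s ^ k) * (t - t0) ^ k) sums f (s * t)" if "\<bar>t - t0\<bar> < r / (\<bar>s\<bar> + 1)" for t
  proof -
    have "\<bar>s * t - s * t0\<bar> = \<bar>s\<bar> * \<bar>t - t0\<bar>"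
      by (simp add: abs_mult flip: right_diff_distrib)
    also have "\<dots> \<le> (\<bar>s\<bar> + 1) * \<bar>t - t0\<bar>"
      by (intro mult_right_mono) auto
    also have "\<dots> < r"
      using that by (simp add: field_simps)
    finally have "(\<lambda>k. a k * (s * t - s * t0) ^ k) sums f (s * t)"
      by (rule a)
    moreover have "(s * t - s * t0) ^ k = s ^ k * (t - t0) ^ k" for k
      by (simp flip: right_diff_distrib power_mult_distrib)
    ultimately show ?thesis by (simp add: mult.assoc)
  qed
  then show "\<exists>r>0. \<exists>a. \<forall>t. \<bar>t - t0\<bar> < r \<longrightarrow> (\<lambda>k. a k * (t - t0) ^ k) sums f (s * t)"
    using r by (intro exI[of _ "r / (\<bar>s\<bar> + 1)"] conjI exI[of _ "\<lambda>k. a k * s ^ k"]) auto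
qed

section \<open>Derivatives and primitives\<close>

lemma Re_holomorphic_has_real_derivative:
  assumes "(G has_field_derivative G') (at (complex_of_real t))"
  shows "((\<lambda>t. Re (G (of_real t))) has_real_derivative Re G') (at t)"
proof -
  have "((G \<circ> of_real) has_vector_derivative (1 * G')) (at t)"
    using assms by (intro field_vector_diff_chain_at) (auto intro!: derivative_eq_intros)
  then have "((\<lambda>x. Re ((G \<circ> of_real) x)) has_vector_derivative Re (1 * G')) (at t)"
    by (rule bounded_linear.has_vector_derivative[OF bounded_linear_Re])
  then show ?thesis
    by (simp add: has_real_derivative_iff_has_vector_derivative o_def)
qed

lemma real_analytic_deriv:
  assumes "real_analytic f"
  shows "(f has_real_derivative deriv f t) (at t)" "real_analytic (deriv f)"
proof -
  have *: "\<exists>r>0. \<exists>g. g holomorphic_on ball (complex_of_real t0) r \<and>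
      (\<forall>t. \<bar>t - t0\<bar> < r \<longrightarrow> (f has_real_derivative Re (g (of_real t))) (at t))" for t0
  proof -
    obtain r g where g: "r > 0" "g holomorphic_on ball (of_real t0) r"
      "\<And>t. \<bar>t - t0\<bar> < r \<Longrightarrow> g (of_real t) = complex_of_real (f t)"
      using real_analytic_holomorphic_extension[OF assms] by blast
    have "(f has_real_derivative Re (deriv g (of_real t))) (at t)" if t: "\<bar>t - t0\<bar> < r" for t
    proof -
      have "(g has_field_derivative deriv g (of_real t)) (at (of_real t))"
        by (rule holomorphic_derivI[OF g(2)]) (use t in \<open>auto simp: dist_real_def abs_minus_commute\<close>)
      then have "((\<lambda>t. Re (g (of_real t))) has_real_derivative Re (deriv g (of_real t))) (at t)"
        by (rule Re_holomorphic_has_real_derivative)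
      moreover have "open {x. \<bar>x - t0\<bar> < r}"
        by (intro open_Collect_less continuous_intros)
      ultimately show ?thesis
        by (rule has_field_derivative_transform_within_open) (use t g(3) in auto)
    qed
    moreover have "deriv g holomorphic_on ball (complex_of_real t0) r"
      using g by (intro holomorphic_deriv) auto
    ultimately show ?thesis using g(1) by blast
  qed
  show "(f has_real_derivative deriv f t) (at t)"
  proof -
    obtain r g where "r > 0" "\<And>t'. \<bar>t' - t\<bar> < r \<Longrightarrow> (f has_real_derivative Re (g (complex_of_real t'))) (at t')"
      using *[of t] by blast
    then have "(f has_real_derivative Re (g (complex_of_real t))) (at t)"
      by simp
    then show ?thesis
      by (simp add: DERIV_imp_deriv)
  qed
  show "real_analytic (deriv f)"
  proof (rule real_analyticI_holomorphic)
    show "\<exists>r>0. \<exists>g. g holomorphic_on ball (complex_of_real t0) r \<and>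
        (\<forall>t. \<bar>t - t0\<bar> < r \<longrightarrow> Re (g (of_real t)) = deriv f t)" for t0
      using *[of t0] by (metis DERIV_imp_deriv)
  qed
qed

text \<open>On a ball the holomorphic extension of \<open>f\<close> has a primitive
  \<open>G\<close>. Along the axis \<open>Re G\<close> and \<open>F\<close> have the same
  derivative, so they differ by the constant \<open>c\<close>, which is subtracted from
  \<open>G\<close>.\<close>

lemma real_analytic_antiderivative:
  assumes "real_analytic f" and F: "\<And>t. (F has_real_derivative f t) (at t)"
  shows "real_analytic F"
proof (rule real_analyticI_holomorphic)
  fix t0
  let ?B = "ball (complex_of_real t0)"
  obtain r g where g: "r > 0" "g holomorphic_on ?B r"
    "\<And>t. \<bar>t - t0\<bar> < r \<Longrightarrow> g (of_real t) = complex_of_real (f t)"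
    using real_analytic_holomorphic_extension[OF assms(1)] by blast
  obtain G where G: "\<And>z. z \<in> ?B r \<Longrightarrow> (G has_field_derivative g z) (at z within ?B r)"
    using holomorphic_convex_primitive'[OF convex_ball open_ball g(2)] by blast
  then have G': "(G has_field_derivative g z) (at z)" if "z \<in> ?B r" for z
    using that at_within_open[OF that open_ball] by metis
  have der: "((\<lambda>t. Re (G (of_real t)) - F t) has_real_derivative 0) (at t)" if t: "\<bar>t - t0\<bar> < r" for t
  proof -
    have "((\<lambda>t. Re (G (of_real t))) has_real_derivative Re (g (of_real t))) (at t)"
      using t by (intro Re_holomorphic_has_real_derivative G') (simp add: dist_real_def abs_minus_commute)
    from DERIV_diff[OF this F[of t]] show ?thesis
      using g(3)[OF t] by simp
  qed
  define c where "c = Re (G (of_real t0)) - F t0"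
  have "Re (G (of_real t)) - F t = c" if t: "\<bar>t - t0\<bar> < r" for t
  proof -
    have "((\<lambda>t. Re (G (of_real t)) - F t) has_real_derivative 0) (at x within {t0 - r<..<t0 + r})"
      if "x \<in> {t0 - r<..<t0 + r}" for x
      by (rule has_field_derivative_at_within, rule der) (use that in auto)
    then obtain c' where c': "\<And>x. x \<in> {t0 - r<..<t0 + r} \<Longrightarrow> Re (G (of_real x)) - F x = c'"
      using has_field_derivative_zero_constant[of "{t0 - r<..<t0 + r}" "\<lambda>x. Re (G (of_real x)) - F x"]
      by auto
    have "t \<in> {t0 - r<..<t0 + r}" "t0 \<in> {t0 - r<..<t0 + r}"
      using t g(1) by auto
    then show ?thesis
      unfolding c_def by (simp only: c')
  qed
  moreover have "(\<lambda>z. G z - of_real c) holomorphic_on ?B r"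
    unfolding holomorphic_on_def field_differentiable_def
    by (intro ballI exI, rule DERIV_diff[OF G DERIV_const])
  ultimately show "\<exists>r>0. \<exists>g. g holomorphic_on ?B r \<and>
      (\<forall>t. \<bar>t - t0\<bar> < r \<longrightarrow> Re (g (of_real t)) = F t)"
    using g(1) by (intro exI[of _ r] conjI exI[of _ "\<lambda>z. G z - of_real c"]) (auto simp: algebra_simps)
qed

lemma real_analytic_isCont: "real_analytic f \<Longrightarrow> isCont f t"
  using real_analytic_deriv(1) DERIV_isCont by blast

lemma real_analytic_higher_deriv: "real_analytic f \<Longrightarrow> real_analytic ((deriv ^^ k) f)"
  by (induction k) (auto intro: real_analytic_deriv)

section \<open>Taylor coefficients and the identity theorem\<close>

text \<open>\<open>diffs\<close> shifts the coefficients and multiplies them by positive integers,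
  so vanishing is merely shifted.\<close>

lemma funpow_diffs_eq_0_iff:
  fixes a :: "nat \<Rightarrow> real"
  shows "(diffs ^^ k) a m = 0 \<longleftrightarrow> a (m + k) = 0"
proof (induction k arbitrary: a m)
  case (Suc k)
  have "(diffs ^^ Suc k) a m = (diffs ^^ k) (diffs a) m"
    by (simp only: funpow_Suc_right o_apply)
  moreover have "diffs a (m + k) = 0 \<longleftrightarrow> a (m + Suc k) = 0"
    by (simp add: diffs_def)
  ultimately show ?case
    by (simp only: Suc)
qed simp

lemma sums_deriv:
  fixes a :: "nat \<Rightarrow> real"
  assumes f: "\<And>t. \<bar>t - t0\<bar> < r \<Longrightarrow> (\<lambda>k. a k * (t - t0) ^ k) sums f t"
    and t: "\<bar>t - t0\<bar> < r"
  shows "(\<lambda>k. diffs a k * (t - t0) ^ k) sums deriv f t"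
    and "(f has_real_derivative deriv f t) (at t)"
proof -
  let ?g = "\<lambda>x. \<Sum>k. a k * x ^ k"
  have s: "(\<lambda>k. a k * x ^ k) sums f (x + t0)" if "norm x < r" for x
    using f[of "x + t0"] that by simp
  have "(?g has_real_derivative (\<Sum>k. diffs a k * (t - t0) ^ k)) (at (t - t0))"
    by (rule termdiffs_strong'[of r]) (use t s in \<open>auto simp: sums_iff\<close>)
  then have "((\<lambda>x. ?g (x + - t0)) has_real_derivative (\<Sum>k. diffs a k * (t - t0) ^ k)) (at t)"
    using DERIV_shift[of ?g _ t "- t0"] by simp
  moreover have "open {x. \<bar>x - t0\<bar> < r}"
    by (intro open_Collect_less continuous_intros)
  ultimately have D: "(f has_real_derivative (\<Sum>k. diffs a k * (t - t0) ^ k)) (at t)"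
    by (rule has_field_derivative_transform_within_open) (use t f in \<open>auto simp: sums_iff\<close>)
  then show "(f has_real_derivative deriv f t) (at t)"
    by (simp add: DERIV_imp_deriv)
  have "summable (\<lambda>k. diffs a k * (t - t0) ^ k)"
    by (rule termdiff_converges[of _ r]) (use t s in \<open>auto simp: sums_iff\<close>)
  then show "(\<lambda>k. diffs a k * (t - t0) ^ k) sums deriv f t"
    using D by (simp add: DERIV_imp_deriv summable_sums)
qed

lemma sums_higher_deriv:
  fixes a :: "nat \<Rightarrow> real"
  assumes f: "\<And>t. \<bar>t - t0\<bar> < r \<Longrightarrow> (\<lambda>k. a k * (t - t0) ^ k) sums f t"
    and t: "\<bar>t - t0\<bar> < r"
  shows "(\<lambda>k. (diffs ^^ m) a k * (t - t0) ^ k) sums (deriv ^^ m) f t"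
  using t by (induction m arbitrary: t) (auto intro: f sums_deriv(1))

text \<open>At the centre, the series of the \<open>k\<close>-th derivative reduces to its constant
  term, a nonzero multiple of the coefficient \<open>a k\<close>.\<close>

lemma real_analytic_locally_zero:
  assumes "real_analytic f" and "\<And>k. (deriv ^^ k) f t0 = 0"
  shows "\<exists>r>0. \<forall>t. \<bar>t - t0\<bar> < r \<longrightarrow> f t = 0"
proof -
  obtain r a where r: "r > 0"
    and a: "\<And>t. \<bar>t - t0\<bar> < r \<Longrightarrow> (\<lambda>k. a k * (t - t0) ^ k) sums f t"
    using assms(1) unfolding real_analytic_def by blast
  have "a k = 0" for k
  proof -
    have "(\<lambda>m. (diffs ^^ k) a m * (t0 - t0) ^ m) sums (deriv ^^ k) f t0"
      by (rule sums_higher_deriv[OF a]) (use r in auto)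
    moreover have "(\<lambda>m. (diffs ^^ k) a m * (t0 - t0) ^ m) sums (diffs ^^ k) a 0"
      using powser_sums_zero[of "(diffs ^^ k) a"] by simp
    ultimately have "(diffs ^^ k) a 0 = 0"
      using assms(2) sums_unique2 by metis
    then show ?thesis
      by (simp add: funpow_diffs_eq_0_iff)
  qed
  then have "f t = 0" if "\<bar>t - t0\<bar> < r" for t
    using a[OF that] by (simp add: sums_iff)
  then show ?thesis using r by blast
qed

lemma real_analytic_zero_dichotomy:
  assumes "real_analytic f"
  shows "(\<exists>r>0. \<forall>t. \<bar>t - t0\<bar> < r \<longrightarrow> f t = 0) \<or> (\<exists>r>0. \<forall>t. \<bar>t - t0\<bar> < r \<and> t \<noteq> t0 \<longrightarrow> f t \<noteq> 0)"
proof -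
  obtain r a where r: "r > 0"
    and a: "\<And>t. norm (t - t0) < r \<Longrightarrow> (\<lambda>k. a k * (t - t0) ^ k) sums f t"
    using assms unfolding real_analytic_def real_norm_def by blast
  consider "f t0 \<noteq> 0" | "f t0 = 0" "\<forall>m>0. a m = 0" | m where "f t0 = 0" "m > 0" "a m \<noteq> 0"
    by blast
  then show ?thesis
  proof cases
    case 1
    obtain e where "e > 0" "\<forall>y. dist t0 y < e \<longrightarrow> f y \<noteq> 0"
      using continuous_at_avoid[OF real_analytic_isCont[OF assms] 1] by auto
    then show ?thesis
      by (intro disjI2 exI[of _ e]) (auto simp: dist_real_def)
  next
    case 2
    have "f t = 0" if "\<bar>t - t0\<bar> < r" for t
    proof -
      have "a 0 = f t0"
        using a[of t0] r powser_sums_zero[of a] sums_unique2 by (simp add: sums_iff)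
      then have "a k = 0" for k
        using 2 by (cases k) auto
      then show ?thesis
        using a[of t] that by (simp add: sums_iff)
    qed
    then show ?thesis using r by blast
  next
    case 3
    obtain s where "0 < s" "\<And>z. z \<in> cball t0 s - {t0} \<Longrightarrow> f z \<noteq> 0"
      using powser_0_nonzero[OF r a 3(1) 3(3) 3(2)] by blast
    then show ?thesis
      by (intro disjI2 exI[of _ s]) (auto simp: dist_real_def)
  qed
qed

text \<open>Connectedness of the line: the set of points near which \<open>f\<close> vanishes is
  open by definition, and its complement is open because zeros outside it are isolated.\<close>

lemma real_analytic_identity:
  assumes f: "real_analytic f" and "r > 0" "\<And>t. \<bar>t - t0\<bar> < r \<Longrightarrow> f t = 0"
  shows "f t = 0"
proof -
  let ?Z = "{t0. \<exists>r>0. \<forall>t. \<bar>t - t0\<bar> < r \<longrightarrow> f t = 0}"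
  have "open ?Z"
    unfolding open_dist
  proof
    fix x assume "x \<in> ?Z"
    then obtain r where r: "r > 0" "\<forall>t. \<bar>t - x\<bar> < r \<longrightarrow> f t = 0" by blast
    have "y \<in> ?Z" if "dist y x < r / 2" for y
    proof -
      have "\<bar>t - x\<bar> < r" if "\<bar>t - y\<bar> < r / 2" for t
        using that \<open>dist y x < r / 2\<close> unfolding dist_real_def by linarith
      then show ?thesis
        using r by (auto intro!: exI[of _ "r / 2"])
    qed
    then show "\<exists>e>0. \<forall>y. dist y x < e \<longrightarrow> y \<in> ?Z"
      using r by (intro exI[of _ "r / 2"]) auto
  qed
  moreover have "open (- ?Z)"
    unfolding open_dist
  proof
    fix x assume "x \<in> - ?Z"
    then obtain s where s: "s > 0" "\<And>t. \<bar>t - x\<bar> < s \<Longrightarrow> t \<noteq> x \<Longrightarrow> f t \<noteq> 0"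
      using real_analytic_zero_dichotomy[OF f, of x] by blast
    have "y \<in> - ?Z" if "dist y x < s" for y
    proof
      assume "y \<in> ?Z"
      then obtain r where r: "r > 0" "\<And>t. \<bar>t - y\<bar> < r \<Longrightarrow> f t = 0" by blast
      \<comment> \<open>Within distance \<open>d\<close> of \<open>y\<close> a point is in the zero
        neighbourhood of \<open>y\<close> and still in the punctured neighbourhood of
        \<open>x\<close>, unless it is \<open>x\<close> itself; \<open>y\<close>, or
        \<open>y + d\<close> if \<open>y = x\<close>, is such a point.\<close>
      define d where "d = min r (s - \<bar>y - x\<bar>) / 2"
      have d: "0 < d" "d < r" "d < s - \<bar>y - x\<bar>"
        using r that unfolding d_def dist_real_def by (auto simp: min_def)
      obtain t where "\<bar>t - y\<bar> \<le> d" "t \<noteq> x"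
      proof (cases "y = x")
        case True
        then show ?thesis using that[of "y + d"] d by auto
      next
        case False
        then show ?thesis using that[of y] d by auto
      qed
      then have "f t = 0" "f t \<noteq> 0"
        using r(2)[of t] s(2)[of t] d by auto
      then show False by simp
    qed
    then show "\<exists>e>0. \<forall>y. dist y x < e \<longrightarrow> y \<in> - ?Z"
      using s by blast
  qed
  moreover have "t0 \<in> ?Z"
    using assms by blast
  ultimately have "?Z = UNIV"
    using clopen[of ?Z] unfolding closed_def by blast
  then have "t \<in> ?Z" by blast
  then show ?thesis by force
qed

text \<open>The identity theorem excludes the first alternative of the dichotomy, so the zeros have
  no limit point.\<close>

lemma countable_zeros_real_analytic:
  assumes f: "real_analytic f" and "f t1 \<noteq> 0"
  shows "countable {t. f t = 0}"
proof -
  have iso: "\<exists>r>0. \<forall>t. \<bar>t - x\<bar> < r \<and> t \<noteq> x \<longrightarrow> f t \<noteq> 0" for x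
    using real_analytic_zero_dichotomy[OF f, of x]
  proof
    assume "\<exists>r>0. \<forall>t. \<bar>t - x\<bar> < r \<longrightarrow> f t = 0"
    then have "f t1 = 0"
      using real_analytic_identity[OF f, of _ x t1] by auto
    then show ?thesis using assms(2) by simp
  qed
  have "\<not> x islimpt {t. f t = 0}" for x
    using iso[of x] unfolding islimpt_approachable dist_real_def by auto
  then show ?thesis
    by (intro no_limpt_imp_countable) auto
qed

section \<open>Analytic linear differential equations\<close>

lemma has_vector_derivative_cart_iff:
  fixes f :: "real \<Rightarrow> real^'n"
  shows "(f has_vector_derivative D) (at t) \<longleftrightarrow> (\<forall>i. ((\<lambda>t. f t $ i) has_real_derivative D $ i) (at t))"
proof -
  have "((\<lambda>t. f t \<bullet> axis i 1) has_derivative (\<lambda>x. (x *\<^sub>R D) \<bullet> axis i 1)) (at t)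
      \<longleftrightarrow> ((\<lambda>t. f t $ i) has_real_derivative D $ i) (at t)" for i
    by (simp add: inner_axis has_field_derivative_def mult_commute_abs)
  then show ?thesis
    unfolding has_vector_derivative_def has_derivative_componentwise_within[of f]
    by (auto simp: Basis_vec_def)
qed

lemma norm_matrix_vector_mult_le:
  fixes A :: "real^'n^'m"
  shows "norm (A *v x) \<le> real CARD('m) * norm A * norm x"
proof -
  have "\<bar>(A *v x) $ i\<bar> \<le> norm A * norm x" for i
  proof -
    have "(A *v x) $ i = A $ i \<bullet> x"
      by (simp add: matrix_vector_mult_def inner_vec_def)
    also have "\<bar>\<dots>\<bar> \<le> norm (A $ i) * norm x"
      by (rule Cauchy_Schwarz_ineq2)
    also have "\<dots> \<le> norm A * norm x"
      by (intro mult_right_mono Finite_Cartesian_Product.norm_nth_le) simp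
    finally show ?thesis .
  qed
  then have "(\<Sum>i\<in>UNIV. \<bar>(A *v x) $ i\<bar>) \<le> of_nat (card (UNIV :: 'm set)) * (norm A * norm x)"
    by (intro sum_bounded_above)
  then show ?thesis
    using norm_le_l1_cart[of "A *v x"] by (simp add: mult.assoc)
qed

lemma continuous_on_matrix_entries:
  fixes A :: "real \<Rightarrow> real^'n^'m"
  assumes "\<And>i j. continuous_on S (\<lambda>t. A t $ i $ j)"
  shows "continuous_on S A"
proof -
  have "continuous_on S (\<lambda>t. \<chi> i. \<chi> j. A t $ i $ j)"
    by (intro continuous_on_vec_lambda assms)
  then show ?thesis by simp
qed

text \<open>Gronwall's argument: if \<open>C\<close> bounds the growth rate,
  \<open>exp (-2*C*s) * (D s \<bullet> D s)\<close> is nonincreasing and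
  \<open>exp (2*C*s) * (D s \<bullet> D s)\<close> is nondecreasing, which carries the zero at
  \<open>t0\<close> forwards and backwards. The equation is required only on an interval, so that
  local power series solutions can be compared.\<close>

lemma linear_ode_zero:
  fixes A :: "real \<Rightarrow> real^'n^'n"
  assumes A: "continuous_on UNIV A"
    and D: "\<And>t. a < t \<Longrightarrow> t < b \<Longrightarrow> (D has_vector_derivative A t *v D t) (at t)"
    and t0: "a < t0" "t0 < b" "D t0 = 0" and t: "a < t" "t < b"
  shows "D t = 0"
proof -
  define lo hi where "lo = min t0 t" and "hi = max t0 t"
  have lohi: "a < s" "s < b" if "lo \<le> s" "s \<le> hi" for s
    using that t0 t by (auto simp: lo_def hi_def)
  have "compact (A ` {lo..hi})"
    using A by (intro compact_continuous_image) (auto intro: continuous_on_subset)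
  then have "bounded (A ` {lo..hi})"
    by (rule compact_imp_bounded)
  then obtain C0 where "\<forall>x\<in>A ` {lo..hi}. norm x \<le> C0"
    unfolding bounded_iff ..
  then have C0: "norm (A s) \<le> C0" if "lo \<le> s" "s \<le> hi" for s
    using that by simp
  define C where "C = real CARD('n) * C0"
  have C: "\<bar>D s \<bullet> (A s *v D s)\<bar> \<le> C * (D s \<bullet> D s)" if "lo \<le> s" "s \<le> hi" for s
  proof -
    have "\<bar>D s \<bullet> (A s *v D s)\<bar> \<le> norm (D s) * norm (A s *v D s)"
      by (rule Cauchy_Schwarz_ineq2)
    also have "\<dots> \<le> norm (D s) * (real CARD('n) * norm (A s) * norm (D s))"
      by (intro mult_left_mono norm_matrix_vector_mult_le) simp
    also have "\<dots> \<le> norm (D s) * (C * norm (D s))"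
      unfolding C_def using C0[OF that] by (intro mult_left_mono mult_right_mono) auto
    also have "\<dots> = C * (D s \<bullet> D s)"
      by (simp add: power2_norm_eq_inner[symmetric] power2_eq_square)
    finally show ?thesis .
  qed
  have der: "((\<lambda>s. exp (k * s) * (D s \<bullet> D s)) has_real_derivative
      exp (k * s) * (k * (D s \<bullet> D s) + 2 * (D s \<bullet> (A s *v D s)))) (at s)"
    if "lo \<le> s" "s \<le> hi" for s k
  proof -
    have "(D has_derivative (\<lambda>x. x *\<^sub>R (A s *v D s))) (at s)"
      using D lohi that unfolding has_vector_derivative_def by blast
    then have "((\<lambda>s. D s \<bullet> D s) has_derivative (\<lambda>x. D s \<bullet> (x *\<^sub>R (A s *v D s)) + (x *\<^sub>R (A s *v D s)) \<bullet> D s)) (at s)"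
      by (intro has_derivative_inner)
    moreover have "(\<lambda>x. D s \<bullet> (x *\<^sub>R (A s *v D s)) + (x *\<^sub>R (A s *v D s)) \<bullet> D s) = (*) (2 * (D s \<bullet> (A s *v D s)))"
      by (auto simp: inner_commute)
    ultimately have "((\<lambda>s. D s \<bullet> D s) has_real_derivative 2 * (D s \<bullet> (A s *v D s))) (at s)"
      by (simp add: has_field_derivative_def)
    then show ?thesis
      by (auto intro!: derivative_eq_intros simp: algebra_simps)
  qed
  have "D t \<bullet> D t \<le> 0"
  proof (cases "t0 \<le> t")
    case True
    have "exp (- 2 * C * t0) * (D t0 \<bullet> D t0) \<ge> exp (- 2 * C * t) * (D t \<bullet> D t)"
    proof (rule DERIV_nonpos_imp_nonincreasing[OF True])
      fix s assume "t0 \<le> s" "s \<le> t"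
      then have s: "lo \<le> s" "s \<le> hi" using True by (auto simp: lo_def hi_def)
      show "\<exists>y. ((\<lambda>s. exp (- 2 * C * s) * (D s \<bullet> D s)) has_real_derivative y) (at s) \<and> y \<le> 0"
        by (intro exI conjI, rule der[OF s]) (use C[OF s] in \<open>auto intro!: mult_nonneg_nonpos\<close>)
    qed
    then show ?thesis using t0(3) by (simp add: mult_le_0_iff)
  next
    case False
    then have le: "t \<le> t0" by simp
    have "exp (2 * C * t) * (D t \<bullet> D t) \<le> exp (2 * C * t0) * (D t0 \<bullet> D t0)"
    proof (rule DERIV_nonneg_imp_nondecreasing[OF le])
      fix s assume "t \<le> s" "s \<le> t0"
      then have s: "lo \<le> s" "s \<le> hi" using le by (auto simp: lo_def hi_def)
      show "\<exists>y. ((\<lambda>s. exp (2 * C * s) * (D s \<bullet> D s)) has_real_derivative y) (at s) \<and> 0 \<le> y"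
        by (intro exI conjI, rule der[OF s]) (use C[OF s] in auto)
    qed
    then show ?thesis using t0(3) by (simp add: mult_le_0_iff)
  qed
  then have "D t \<bullet> D t = 0"
    by (intro antisym) simp_all
  then show ?thesis by simp
qed

section \<open>Power series solutions by majorants\<close>

text \<open>The terms of a series converging at distance \<open>s\<close> are bounded, so the
  coefficients grow at most like powers of \<open>R = 1 / s\<close>.\<close>

lemma real_analytic_coeff_bound:
  assumes "real_analytic f"
  shows "\<exists>a C R. C \<ge> 0 \<and> R > 0 \<and> (\<forall>k. \<bar>a k\<bar> \<le> C * R ^ k) \<and>
    (\<forall>t. \<bar>t - t0\<bar> < 1 / R \<longrightarrow> (\<lambda>k. a k * (t - t0) ^ k) sums f t)"
proof -
  obtain r a where r: "r > 0"
    and a: "\<And>t. \<bar>t - t0\<bar> < r \<Longrightarrow> (\<lambda>k. a k * (t - t0) ^ k) sums f t"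
    using assms unfolding real_analytic_def by blast
  define s where "s = r / 2"
  have s: "0 < s" "s < r"
    using r by (auto simp: s_def)
  have "summable (\<lambda>k. a k * s ^ k)"
    using a[of "t0 + s"] s by (simp add: sums_iff)
  then obtain C where C: "C > 0" "\<forall>k. norm (a k * s ^ k) \<le> C"
    by (rule BseqE[OF summable_imp_Bseq])
  have "\<bar>a k\<bar> \<le> C * (1 / s) ^ k" for k
    using spec[OF C(2), of k] s by (simp add: abs_mult power_divide field_simps)
  then show ?thesis
    using C(1) s a by (intro exI[of _ a] exI[of _ C] exI[of _ "1 / s"]) auto
qed

text \<open>Comparison of coefficients in \<open>Y' = A Y\<close>: \<open>a l i j\<close> is the
  coefficient of order \<open>l\<close> of the matrix entry \<open>(i, j)\<close>, the sum over
  \<open>l\<close> is the Cauchy product, and \<open>v\<close> is the initial value.\<close>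

fun ode_coeff :: "(nat \<Rightarrow> 'n::finite \<Rightarrow> 'n \<Rightarrow> real) \<Rightarrow> ('n \<Rightarrow> real) \<Rightarrow> nat \<Rightarrow> 'n \<Rightarrow> real" where
  "ode_coeff a v 0 = v"
| "ode_coeff a v (Suc k) =
    (\<lambda>i. (\<Sum>l\<le>k. \<Sum>j\<in>UNIV. a l i j * ode_coeff a v (k - l) j) / real (Suc k))"

text \<open>In the recurrence, the division by \<open>Suc m\<close> cancels the number of values of
  \<open>l\<close>, and the sum over \<open>j\<close> costs the factor \<open>CARD('n) * C\<close>,
  which \<open>S\<close> absorbs.\<close>

lemma ode_coeff_bound:
  fixes a :: "nat \<Rightarrow> 'n::finite \<Rightarrow> 'n \<Rightarrow> real"
  assumes a: "\<And>l i j. \<bar>a l i j\<bar> \<le> C * R ^ l" and "C \<ge> 0" "R > 0"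
    and S: "R \<le> S" "real CARD('n) * C \<le> S" and v: "\<And>i. \<bar>v i\<bar> \<le> M"
  shows "\<bar>ode_coeff a v k i\<bar> \<le> M * S ^ k"
proof (induction k arbitrary: i rule: less_induct)
  case (less k)
  have M: "M \<ge> 0"
    using v[of undefined] by linarith
  show ?case
  proof (cases k)
    case 0
    then show ?thesis using v by simp
  next
    case (Suc m)
    have 1: "\<bar>a l i j * ode_coeff a v (m - l) j\<bar> \<le> C * M * S ^ m" if "l \<le> m" for l j
    proof -
      have "\<bar>a l i j * ode_coeff a v (m - l) j\<bar> \<le> (C * R ^ l) * (M * S ^ (m - l))"
        unfolding abs_mult using assms(2,3) Suc by (intro mult_mono a less) auto
      also have "\<dots> \<le> (C * S ^ l) * (M * S ^ (m - l))"
        using assms(2,3) S M by (intro mult_right_mono mult_left_mono power_mono) auto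
      also have "\<dots> = C * M * S ^ m"
        using that by (simp add: power_add[symmetric] mult_ac flip: mult.assoc)
      finally show ?thesis .
    qed
    have "\<bar>\<Sum>l\<le>m. \<Sum>j\<in>UNIV. a l i j * ode_coeff a v (m - l) j\<bar>
        \<le> (\<Sum>l\<le>m. \<Sum>j\<in>(UNIV :: 'n set). C * M * S ^ m)"
      by (intro order_trans[OF sum_abs] sum_mono order_trans[OF sum_abs] 1) auto
    also have "\<dots> = real (Suc m) * ((real CARD('n) * C) * (M * S ^ m))"
      by simp
    also have "\<dots> \<le> real (Suc m) * (S * (M * S ^ m))"
      using S M assms(3) by (intro mult_left_mono mult_right_mono) auto
    finally have "\<bar>\<Sum>l\<le>m. \<Sum>j\<in>UNIV. a l i j * ode_coeff a v (m - l) j\<bar> / real (Suc m) \<le> S * (M * S ^ m)"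
      by (simp add: divide_le_eq mult_ac)
    then show ?thesis
      by (simp add: Suc mult_ac)
  qed
qed

text \<open>The formal series solution converges by the majorant bound, and termwise differentiation
  shows that it solves the equation.\<close>

lemma analytic_linear_ode_local:
  fixes A :: "real \<Rightarrow> real^'n^'n"
  assumes "analytic_mat A"
  shows "\<exists>r>0. \<exists>Y. Y t0 = v \<and> (\<forall>i. \<exists>x. \<forall>t. \<bar>t - t0\<bar> < r \<longrightarrow> (\<lambda>k. x k * (t - t0) ^ k) sums (Y t $ i)) \<and>
    (\<forall>t. \<bar>t - t0\<bar> < r \<longrightarrow> (Y has_vector_derivative A t *v Y t) (at t))"
proof -
  have "\<forall>i j. \<exists>a C R. C \<ge> 0 \<and> R > 0 \<and> (\<forall>k. \<bar>a k\<bar> \<le> C * R ^ k) \<and>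
      (\<forall>t. \<bar>t - t0\<bar> < 1 / R \<longrightarrow> (\<lambda>k. a k * (t - t0) ^ k) sums (A t $ i $ j))"
    using assms real_analytic_coeff_bound unfolding analytic_mat_def by blast
  then obtain a C R where *: "\<forall>i j. C i j \<ge> 0 \<and> R i j > 0 \<and> (\<forall>k. \<bar>a i j k\<bar> \<le> C i j * R i j ^ k) \<and>
      (\<forall>t. \<bar>t - t0\<bar> < 1 / R i j \<longrightarrow> (\<lambda>k. a i j k * (t - t0) ^ k) sums (A t $ i $ j))"
    unfolding choice_iff by iprover
  then have C: "C i j \<ge> 0" and R: "R i j > 0" and a: "\<bar>a i j k\<bar> \<le> C i j * R i j ^ k"
    and sums: "\<bar>t - t0\<bar> < 1 / R i j \<Longrightarrow> (\<lambda>k. a i j k * (t - t0) ^ k) sums (A t $ i $ j)" for i j k t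
    by simp_all
  \<comment> \<open>Sums of the nonnegative entry constants serve as bounds common to all
    entries.\<close>
  define C' where "C' = (\<Sum>i\<in>UNIV. \<Sum>j\<in>UNIV. C i j)"
  define R' where "R' = (\<Sum>i\<in>UNIV. \<Sum>j\<in>UNIV. R i j)"
  have le: "f i j \<le> (\<Sum>i\<in>UNIV. \<Sum>j\<in>UNIV. f i j)" if "\<And>i j. f i j \<ge> 0" for f :: "'n \<Rightarrow> 'n \<Rightarrow> real" and i j
    using that
    by (intro order_trans[OF member_le_sum[of j UNIV "f i"] member_le_sum[of i UNIV "\<lambda>i. \<Sum>j\<in>UNIV. f i j"]])
       (auto intro: sum_nonneg)
  have C': "C i j \<le> C'" and R': "R i j \<le> R'" for i j
    unfolding C'_def R'_def by (rule le, rule C, rule le, rule less_imp_le, rule R)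
  have R'0: "R' > 0"
    using R'[of undefined undefined] R[of undefined undefined] by linarith
  have C'0: "C' \<ge> 0"
    using C'[of undefined undefined] C[of undefined undefined] by linarith
  define S where "S = max R' (real CARD('n) * C')"
  have S: "R' \<le> S" "real CARD('n) * C' \<le> S" "S > 0"
    using R'0 by (auto simp: S_def)
  define b where "b l i j = a i j l" for l i j
  have b: "\<bar>b l i j\<bar> \<le> C' * R' ^ l" for l i j
  proof -
    have "\<bar>b l i j\<bar> \<le> C i j * R i j ^ l"
      using a by (simp add: b_def)
    also have "\<dots> \<le> C' * R' ^ l"
      using C R C' R' C'0 by (intro mult_mono power_mono) (auto intro: less_imp_le)
    finally show ?thesis .
  qed
  define x where "x = ode_coeff b (\<lambda>i. v $ i)"
  have x: "\<bar>x k i\<bar> \<le> norm v * S ^ k" for k i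
    unfolding x_def using b C'0 R'0 S
    by (intro ode_coeff_bound[where C = C' and R = R'] component_le_norm_cart) auto
  define Y where "Y t = (\<chi> i. \<Sum>k. x k i * (t - t0) ^ k)" for t
  \<comment> \<open>Absolute convergence, as the Cauchy product requires; used both for the entries
    of \<open>A\<close> and for the solution.\<close>
  have geo: "summable (\<lambda>k. norm (c k * h ^ k))"
    if c: "\<And>k. \<bar>c k\<bar> \<le> B * T ^ k" and "T \<le> S" "0 < T" and h: "\<bar>h\<bar> < 1 / S" for c B T h
  proof (rule summable_comparison_test')
    have "T * \<bar>h\<bar> \<le> S * \<bar>h\<bar>"
      using that by (intro mult_right_mono) auto
    also have "\<dots> < 1"
      using h S by (simp add: field_simps)
    finally show "summable (\<lambda>k. B * (T * \<bar>h\<bar>) ^ k)"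
      using that by (intro summable_mult summable_geometric) (simp add: abs_mult)
    show "norm (norm (c k * h ^ k)) \<le> B * (T * \<bar>h\<bar>) ^ k" if "k \<ge> 0" for k
    proof -
      have "\<bar>c k\<bar> * \<bar>h\<bar> ^ k \<le> (B * T ^ k) * \<bar>h\<bar> ^ k"
        using c by (intro mult_right_mono) auto
      then show ?thesis
        by (simp add: abs_mult power_abs power_mult_distrib mult_ac)
    qed
  qed
  have Ysums: "(\<lambda>k. x k i * (t - t0) ^ k) sums (Y t $ i)" if t: "\<bar>t - t0\<bar> < 1 / S" for i t
    unfolding Y_def vec_lambda_beta
    by (intro summable_sums summable_norm_cancel[OF geo[of _ "norm v" S]] x) (use t S in auto)
  have "(Y has_vector_derivative A t *v Y t) (at t)" if t: "\<bar>t - t0\<bar> < 1 / S" for t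
    unfolding has_vector_derivative_cart_iff
  proof
    fix i
    let ?h = "t - t0"
    have At: "(\<lambda>k. b k i j * ?h ^ k) sums (A t $ i $ j)" for j
    proof -
      have "1 / S \<le> 1 / R i j"
        using R S(1) R'[of i j] by (intro divide_left_mono mult_pos_pos) (auto intro: order.strict_trans2 S)
      then show ?thesis
        unfolding b_def using sums t by simp
    qed
    have "(\<lambda>k. \<Sum>l\<le>k. (b l i j * ?h ^ l) * (x (k - l) j * ?h ^ (k - l))) sums (A t $ i $ j * Y t $ j)" for j
    proof -
      have "(\<lambda>k. \<Sum>l\<le>k. (b l i j * ?h ^ l) * (x (k - l) j * ?h ^ (k - l))) sums
          ((\<Sum>k. b k i j * ?h ^ k) * (\<Sum>k. x k j * ?h ^ k))"
        by (intro Cauchy_product_sums geo[of _ C' R'] geo[of _ "norm v" S] b x) (use t S R'0 in auto)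
      then show ?thesis
        using At[of j] Ysums[OF t, of j] by (simp add: sums_iff)
    qed
    then have "(\<lambda>k. \<Sum>j\<in>UNIV. \<Sum>l\<le>k. (b l i j * ?h ^ l) * (x (k - l) j * ?h ^ (k - l))) sums
        (\<Sum>j\<in>UNIV. A t $ i $ j * Y t $ j)"
      by (intro sums_sum)
    moreover have "(\<Sum>j\<in>UNIV. \<Sum>l\<le>k. (b l i j * ?h ^ l) * (x (k - l) j * ?h ^ (k - l)))
        = diffs (\<lambda>k. x k i) k * ?h ^ k" for k
    proof -
      have "(\<Sum>j\<in>UNIV. \<Sum>l\<le>k. (b l i j * ?h ^ l) * (x (k - l) j * ?h ^ (k - l)))
          = (\<Sum>l\<le>k. \<Sum>j\<in>UNIV. (b l i j * ?h ^ l) * (x (k - l) j * ?h ^ (k - l)))"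
        by (rule sum.swap)
      also have "\<dots> = (\<Sum>l\<le>k. \<Sum>j\<in>UNIV. b l i j * x (k - l) j * ?h ^ k)"
        by (intro sum.cong refl) (simp add: mult_ac flip: power_add)
      also have "\<dots> = (\<Sum>l\<le>k. \<Sum>j\<in>UNIV. b l i j * x (k - l) j) * ?h ^ k"
        by (simp add: sum_distrib_right)
      also have "\<dots> = diffs (\<lambda>k. x k i) k * ?h ^ k"
        by (simp add: diffs_def x_def del: of_nat_Suc)
      finally show ?thesis .
    qed
    ultimately have "(\<lambda>k. diffs (\<lambda>k. x k i) k * ?h ^ k) sums ((A t *v Y t) $ i)"
      by (simp add: matrix_vector_mult_def)
    moreover have "(\<lambda>k. diffs (\<lambda>k. x k i) k * ?h ^ k) sums deriv (\<lambda>t. Y t $ i) t"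
      by (rule sums_deriv(1)[OF Ysums t])
    ultimately have "deriv (\<lambda>t. Y t $ i) t = (A t *v Y t) $ i"
      by (rule sums_unique2[symmetric])
    then show "((\<lambda>t. Y t $ i) has_real_derivative (A t *v Y t) $ i) (at t)"
      using sums_deriv(2)[OF Ysums t, of i] by simp
  qed
  moreover have "Y t0 = v"
  proof -
    have "Y t0 $ i = v $ i" for i
      using sums_unique2[OF Ysums[of t0 i], of "x 0 i"] S(3) powser_sums_zero[of "\<lambda>k. x k i"]
      by (simp add: x_def)
    then show ?thesis by (simp add: vec_eq_iff)
  qed
  moreover have "\<exists>x. \<forall>t. \<bar>t - t0\<bar> < 1 / S \<longrightarrow> (\<lambda>k. x k * (t - t0) ^ k) sums (Y t $ i)" for i
    using Ysums by (intro exI[of _ "\<lambda>k. x k i"]) simp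
  ultimately show ?thesis
    using S(3) by (intro exI[of _ "1 / S"] exI[of _ Y] conjI allI impI) auto
qed

lemma analytic_mat_continuous: "analytic_mat A \<Longrightarrow> continuous_on UNIV A"
  unfolding analytic_mat_def
  by (intro continuous_on_matrix_entries continuous_at_imp_continuous_on ballI real_analytic_isCont) auto

text \<open>By uniqueness, \<open>X\<close> coincides near each \<open>t0\<close> with the power
  series solution having the same value at \<open>t0\<close>.\<close>

lemma analytic_linear_ode:
  fixes A :: "real \<Rightarrow> real^'n^'n"
  assumes A: "analytic_mat A" and X: "\<And>t. (X has_vector_derivative A t *v X t) (at t)"
  shows "analytic_vec X"
  unfolding analytic_vec_def real_analytic_def
proof (intro allI)
  fix i t0
  obtain r Y where r: "r > 0" and Y0: "Y t0 = X t0"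
    and Ys: "\<And>i. \<exists>x. \<forall>t. \<bar>t - t0\<bar> < r \<longrightarrow> (\<lambda>k. x k * (t - t0) ^ k) sums (Y t $ i)"
    and Y: "\<And>t. \<bar>t - t0\<bar> < r \<Longrightarrow> (Y has_vector_derivative A t *v Y t) (at t)"
    using analytic_linear_ode_local[OF A, of t0 "X t0"] by blast
  have "Y t - X t = 0" if "\<bar>t - t0\<bar> < r" for t
  proof (rule linear_ode_zero[where a = "t0 - r" and b = "t0 + r" and D = "\<lambda>t. Y t - X t"])
    show "((\<lambda>t. Y t - X t) has_vector_derivative A t *v (Y t - X t)) (at t)"
      if "t0 - r < t" "t < t0 + r" for t
      using that by (auto simp: matrix_vector_mult_diff_distrib intro!: has_vector_derivative_diff X Y)
  qed (use that r Y0 A analytic_mat_continuous in auto)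
  then have "Y t = X t" if "\<bar>t - t0\<bar> < r" for t
    using that by simp
  then show "\<exists>r>0. \<exists>a. \<forall>t. \<bar>t - t0\<bar> < r \<longrightarrow> (\<lambda>k. a k * (t - t0) ^ k) sums (X t $ i)"
    using r Ys[of i] by (intro exI[of _ r]) auto
qed

section \<open>Generic spanning conditions\<close>

lemma analytic_vec_const: "analytic_vec (\<lambda>_. v)"
  by (auto simp: analytic_vec_def)

lemma analytic_vec_add:
  "analytic_vec f \<Longrightarrow> analytic_vec g \<Longrightarrow> analytic_vec (\<lambda>t. f t + g t)"
  by (auto simp: analytic_vec_def)

lemma analytic_vec_diff:
  "analytic_vec f \<Longrightarrow> analytic_vec g \<Longrightarrow> analytic_vec (\<lambda>t. f t - g t)"
  by (auto simp: analytic_vec_def)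

lemma analytic_vec_scale_argument: "analytic_vec f \<Longrightarrow> analytic_vec (\<lambda>t. f (s * t))"
  by (auto simp: analytic_vec_def intro: real_analytic_scale_argument)

lemma analytic_matrix_vector_mult:
  "analytic_mat A \<Longrightarrow> analytic_vec f \<Longrightarrow> analytic_vec (\<lambda>t. A t *v f t)"
  unfolding analytic_vec_def analytic_mat_def matrix_vector_mult_def vec_lambda_beta
  by (intro allI real_analytic_sum real_analytic_mult) simp_all

lemma real_analytic_inner:
  "analytic_vec f \<Longrightarrow> analytic_vec g \<Longrightarrow> real_analytic (\<lambda>t. f t \<bullet> g t)"
  unfolding analytic_vec_def inner_vec_def inner_real_def
  by (intro real_analytic_sum real_analytic_mult) simp_all

lemma real_analytic_det: "analytic_mat A \<Longrightarrow> real_analytic (\<lambda>t. det (A t))"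
  unfolding analytic_mat_def det_def
  by (intro real_analytic_sum real_analytic_mult real_analytic_prod real_analytic_const) simp

lemma analytic_vec_continuous:
  assumes "analytic_vec f"
  shows "continuous_on S f"
proof -
  have "continuous_on S (\<lambda>t. \<chi> i. f t $ i)"
    using assms unfolding analytic_vec_def
    by (intro continuous_on_vec_lambda continuous_at_imp_continuous_on ballI real_analytic_isCont) simp
  then show ?thesis by simp
qed

text \<open>The vectors span exactly when their Gram-type matrix \<open>G\<close>, the sum of the
  products \<open>v v^T\<close>, is nonsingular. Its determinant is analytic in
  \<open>\<delta>\<close> and nonzero at \<open>\<delta>0\<close>.\<close>

lemma countable_not_spanning:
  fixes v :: "'l \<Rightarrow> real \<Rightarrow> real^'n"
  assumes v: "\<And>l. l \<in> I \<Longrightarrow> analytic_vec (v l)"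
    and span: "\<And>x. (\<forall>l\<in>I. x \<bullet> v l \<delta>0 = 0) \<Longrightarrow> x = 0" and "finite I"
  shows "countable {\<delta>. \<exists>x. x \<noteq> 0 \<and> (\<forall>l\<in>I. x \<bullet> v l \<delta> = 0)}"
proof -
  define G where "G \<delta> = (\<chi> i j. \<Sum>l\<in>I. v l \<delta> $ i * v l \<delta> $ j)" for \<delta>
  have Gx: "G \<delta> *v x = (\<Sum>l\<in>I. (x \<bullet> v l \<delta>) *\<^sub>R v l \<delta>)" for \<delta> x
  proof -
    have "(G \<delta> *v x) $ i = (\<Sum>l\<in>I. (x \<bullet> v l \<delta>) *\<^sub>R v l \<delta>) $ i" for i
    proof -
      have "(G \<delta> *v x) $ i = (\<Sum>j\<in>UNIV. \<Sum>l\<in>I. v l \<delta> $ i * v l \<delta> $ j * x $ j)"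
        by (simp add: matrix_vector_mult_def G_def sum_distrib_right)
      also have "\<dots> = (\<Sum>l\<in>I. \<Sum>j\<in>UNIV. v l \<delta> $ i * v l \<delta> $ j * x $ j)"
        by (rule sum.swap)
      also have "\<dots> = (\<Sum>l\<in>I. (x \<bullet> v l \<delta>) *\<^sub>R v l \<delta>) $ i"
        by (simp add: inner_vec_def sum_distrib_left mult_ac)
      finally show ?thesis .
    qed
    then show ?thesis by (simp add: vec_eq_iff)
  qed
  have det: "det (G \<delta>) \<noteq> 0 \<longleftrightarrow> (\<forall>x. G \<delta> *v x = 0 \<longrightarrow> x = 0)" for \<delta>
    by (simp only: invertible_det_nz[symmetric] invertible_left_inverse matrix_left_invertible_ker)
  have "analytic_mat G"
    using v unfolding analytic_mat_def analytic_vec_def G_def vec_lambda_beta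
    by (intro allI real_analytic_sum real_analytic_mult) simp_all
  then have "real_analytic (\<lambda>\<delta>. det (G \<delta>))"
    by (rule real_analytic_det)
  moreover have "det (G \<delta>0) \<noteq> 0"
    unfolding det
  proof (intro allI impI)
    fix x assume "G \<delta>0 *v x = 0"
    moreover have "x \<bullet> (G \<delta>0 *v x) = (\<Sum>l\<in>I. (x \<bullet> v l \<delta>0)\<^sup>2)"
      by (simp add: Gx inner_sum_right power2_eq_square)
    ultimately have "(\<Sum>l\<in>I. (x \<bullet> v l \<delta>0)\<^sup>2) = 0"
      by simp
    then have "\<forall>l\<in>I. x \<bullet> v l \<delta>0 = 0"
      using \<open>finite I\<close> by (simp add: sum_nonneg_eq_0_iff)
    then show "x = 0" by (rule span)
  qed
  ultimately have "countable {\<delta>. det (G \<delta>) = 0}"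
    by (rule countable_zeros_real_analytic)
  moreover have "{\<delta>. \<exists>x. x \<noteq> 0 \<and> (\<forall>l\<in>I. x \<bullet> v l \<delta> = 0)} \<subseteq> {\<delta>. det (G \<delta>) = 0}"
  proof clarify
    fix \<delta> x assume "x \<noteq> 0" "\<forall>l\<in>I. x \<bullet> v l \<delta> = 0"
    moreover from this have "G \<delta> *v x = 0"
      by (simp add: Gx)
    ultimately show "det (G \<delta>) = 0"
      using det by blast
  qed
  ultimately show ?thesis
    using countable_subset by blast
qed

section \<open>Many nearby zeros force vanishing\<close>

text \<open>Rolle's theorem between consecutive zeros gives \<open>k\<close> increasing zeros of the
  derivative from \<open>k + 1\<close> zeros of the function. The bounds on \<open>\<xi>\<close> are
  weak because \<open>k = 0\<close> leaves only the point \<open>p 0\<close>.\<close>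

lemma real_analytic_Rolle_higher:
  assumes "real_analytic f" and "\<And>l. l < k \<Longrightarrow> p l < p (Suc l)" and "\<And>l. l \<le> k \<Longrightarrow> f (p l) = 0"
  shows "\<exists>\<xi>. p 0 \<le> \<xi> \<and> \<xi> \<le> p k \<and> (deriv ^^ k) f \<xi> = 0"
  using assms
proof (induction k arbitrary: f p)
  case 0
  then show ?case by (intro exI[of _ "p 0"]) auto
next
  case (Suc k)
  have "\<exists>z. p l < z \<and> z < p (Suc l) \<and> deriv f z = 0" if l: "l \<le> k" for l
  proof -
    have "\<exists>z. p l < z \<and> z < p (Suc l) \<and> DERIV f z :> 0"
    proof (rule Rolle)
      show "p l < p (Suc l)" "f (p l) = f (p (Suc l))"
        using Suc.prems l by auto
      show "continuous_on {p l..p (Suc l)} f"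
        by (intro continuous_at_imp_continuous_on ballI real_analytic_isCont Suc.prems)
      show "f differentiable (at x)" for x
        using real_analytic_deriv(1)[OF Suc.prems(1)] real_differentiable_def by blast
    qed
    then show ?thesis
      using DERIV_imp_deriv by blast
  qed
  then have "\<forall>l. \<exists>z. l \<le> k \<longrightarrow> p l < z \<and> z < p (Suc l) \<and> deriv f z = 0"
    by blast
  then obtain q where q: "\<And>l. l \<le> k \<Longrightarrow> p l < q l \<and> q l < p (Suc l) \<and> deriv f (q l) = 0"
    unfolding choice_iff by blast
  have "q l < q (Suc l)" if "l < k" for l
    using q[of l] q[of "Suc l"] that by auto
  then obtain \<xi> where "q 0 \<le> \<xi>" "\<xi> \<le> q k" "(deriv ^^ k) (deriv f) \<xi> = 0"
    using Suc.IH[of "deriv f" q] real_analytic_deriv(2)[OF Suc.prems(1)] q by blast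
  moreover have "p 0 < q 0" "q k < p (Suc k)"
    using q[of 0] q[of k] by auto
  ultimately show ?case
    by (intro exI[of _ \<xi>]) (simp add: funpow_swap1)
qed

text \<open>By Rolle's theorem, nonzero combinations with too many zeros near \<^term>\<open>\<tau>\<close> would accumulate at
  a nonzero combination all of whose derivatives vanish at \<^term>\<open>\<tau>\<close>.\<close>
lemma analytic_vec_spanning_near:
  fixes g :: "real \<Rightarrow> real^'n"
  assumes g: "analytic_vec g" and indep: "\<forall>x. (\<forall>t. x \<bullet> g t = 0) \<longrightarrow> x = 0"
  shows "\<exists>K0. \<exists>\<eta>>0. \<forall>K\<ge>K0. \<forall>x p. (\<forall>l<K. \<bar>p l - \<tau>\<bar> < \<eta> \<and> x \<bullet> g (p l) = 0) \<longrightarrow>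
    (\<forall>l. Suc l < K \<longrightarrow> p l < p (Suc l)) \<longrightarrow> x = 0"
proof (rule ccontr)
  assume neg: "\<not> ?thesis"
  define D where "D k t = (\<chi> i. (deriv ^^ k) (\<lambda>t. g t $ i) t)" for k t
  have gi: "real_analytic ((deriv ^^ k) (\<lambda>t. g t $ i))" for k i
    using g unfolding analytic_vec_def by (intro real_analytic_higher_deriv) simp
  have D: "(deriv ^^ k) (\<lambda>t. x \<bullet> g t) = (\<lambda>t. x \<bullet> D k t)" for k x
  proof (induction k)
    case 0
    show ?case by (simp add: D_def)
  next
    case (Suc k)
    have "((\<lambda>t. x \<bullet> D k t) has_real_derivative x \<bullet> D (Suc k) t) (at t)" for t
    proof -
      have "((\<lambda>t. \<Sum>i\<in>UNIV. x $ i * (deriv ^^ k) (\<lambda>t. g t $ i) t) has_real_derivative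
          (\<Sum>i\<in>UNIV. x $ i * deriv ((deriv ^^ k) (\<lambda>t. g t $ i)) t)) (at t)"
        by (intro DERIV_sum DERIV_cmult real_analytic_deriv(1) gi)
      then show ?thesis by (simp add: inner_vec_def D_def)
    qed
    then show ?case
      by (simp add: Suc DERIV_imp_deriv fun_eq_iff)
  qed
  have xg: "real_analytic (\<lambda>t. x \<bullet> g t)" for x
    by (intro real_analytic_inner analytic_vec_const g)
  have "\<exists>y. norm y = 1 \<and> (\<forall>k\<le>m. \<exists>\<xi>. \<bar>\<xi> - \<tau>\<bar> < 1 / real (Suc m) \<and> y \<bullet> D k \<xi> = 0)" for m
  proof -
    \<comment> \<open>The negated claim with \<open>K0 = Suc m\<close> and
      \<open>\<eta> = 1 / Suc m\<close>: at least \<open>m + 1\<close> zeros, enough for Rolle up to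
      order \<open>m\<close>.\<close>
    have "\<exists>K\<ge>Suc m. \<exists>x p. (\<forall>l<K. \<bar>p l - \<tau>\<bar> < 1 / real (Suc m) \<and> x \<bullet> g (p l) = 0) \<and>
        (\<forall>l. Suc l < K \<longrightarrow> p l < p (Suc l)) \<and> x \<noteq> 0"
      using neg by (auto simp del: of_nat_Suc dest!: spec[of _ "Suc m"] spec[of _ "1 / real (Suc m)"])
    then obtain K x p where K: "K \<ge> Suc m"
      and p: "\<And>l. l < K \<Longrightarrow> \<bar>p l - \<tau>\<bar> < 1 / real (Suc m)" "\<And>l. l < K \<Longrightarrow> x \<bullet> g (p l) = 0"
        "\<And>l. Suc l < K \<Longrightarrow> p l < p (Suc l)"
      and x: "x \<noteq> 0" by blast
    have "\<exists>\<xi>. \<bar>\<xi> - \<tau>\<bar> < 1 / real (Suc m) \<and> (x /\<^sub>R norm x) \<bullet> D k \<xi> = 0" if "k \<le> m" for k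
    proof -
      have "\<exists>\<xi>. p 0 \<le> \<xi> \<and> \<xi> \<le> p k \<and> (deriv ^^ k) (\<lambda>t. x \<bullet> g t) \<xi> = 0"
        using that K p by (intro real_analytic_Rolle_higher xg) auto
      then obtain \<xi> where "p 0 \<le> \<xi>" "\<xi> \<le> p k" "x \<bullet> D k \<xi> = 0"
        by (auto simp: D)
      then show ?thesis
        using p(1)[of 0] p(1)[of k] that K by (intro exI[of _ \<xi>]) auto
    qed
    then show ?thesis
      using x by (intro exI[of _ "x /\<^sub>R norm x"]) auto
  qed
  then have *: "\<forall>m. \<exists>y. norm y = 1 \<and> (\<forall>k\<le>m. \<exists>\<xi>. \<bar>\<xi> - \<tau>\<bar> < 1 / real (Suc m) \<and> y \<bullet> D k \<xi> = 0)" ..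
  obtain y where y: "\<forall>m. norm (y m) = 1 \<and>
      (\<forall>k\<le>m. \<exists>\<xi>. \<bar>\<xi> - \<tau>\<bar> < 1 / real (Suc m) \<and> y m \<bullet> D k \<xi> = 0)"
    using choice[OF *] ..
  \<comment> \<open>Normalization makes the sphere's compactness available; for each fixed order
    \<open>k\<close> the points \<open>\<xi>\<close> tend to \<open>\<tau>\<close>, so the equation
    passes to the limit.\<close>
  have "\<exists>l\<in>sphere 0 1. \<exists>r. strict_mono r \<and> (y \<circ> r) \<longlonglongrightarrow> l"
    using compact_sphere[of "0 :: real^'n" 1] y unfolding compact_def by auto
  then obtain x r where x: "norm x = 1" and r: "strict_mono (r :: nat \<Rightarrow> nat)" and lim: "(y \<circ> r) \<longlonglongrightarrow> x"
    by auto
  have "x \<bullet> D k \<tau> = 0" for k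
  proof -
    have "\<forall>m. \<exists>\<xi>. k \<le> m \<longrightarrow> \<bar>\<xi> - \<tau>\<bar> < 1 / real (Suc m) \<and> y m \<bullet> D k \<xi> = 0"
      using y by simp
    from choice[OF this] obtain \<xi> where *: "\<forall>m. k \<le> m \<longrightarrow> \<bar>\<xi> m - \<tau>\<bar> < 1 / real (Suc m) \<and> y m \<bullet> D k (\<xi> m) = 0" ..
    then have \<xi>: "\<bar>\<xi> m - \<tau>\<bar> < 1 / real (Suc m)" "y m \<bullet> D k (\<xi> m) = 0" if "k \<le> m" for m
      using that by blast+
    have "(\<lambda>m. \<xi> m - \<tau>) \<longlonglongrightarrow> 0"
    proof (rule Lim_null_comparison)
      show "\<forall>\<^sub>F m in sequentially. norm (\<xi> m - \<tau>) \<le> 1 / real (Suc m)"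
        using eventually_ge_at_top[of k] by eventually_elim (use \<xi>(1) in \<open>auto simp: less_imp_le\<close>)
      show "(\<lambda>m. 1 / real (Suc m)) \<longlonglongrightarrow> 0"
        using LIMSEQ_inverse_real_of_nat by (simp add: inverse_eq_divide)
    qed
    then have "\<xi> \<longlonglongrightarrow> \<tau>"
      by (simp add: LIM_zero_iff)
    then have "(\<lambda>m. \<xi> (r m)) \<longlonglongrightarrow> \<tau>"
      using LIMSEQ_subseq_LIMSEQ[OF _ r] by (fastforce simp: o_def)
    moreover have "isCont (D k) \<tau>"
    proof -
      have "continuous_on UNIV (D k)"
        by (rule analytic_vec_continuous) (simp add: analytic_vec_def D_def gi)
      then show ?thesis by (simp add: continuous_on_eq_continuous_at)
    qed
    ultimately have "(\<lambda>m. D k (\<xi> (r m))) \<longlonglongrightarrow> D k \<tau>"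
      by (rule isCont_tendsto_compose[rotated])
    then have "(\<lambda>m. y (r m) \<bullet> D k (\<xi> (r m))) \<longlonglongrightarrow> x \<bullet> D k \<tau>"
      using lim by (intro tendsto_inner) (simp add: o_def)
    moreover have "\<forall>\<^sub>F m in sequentially. y (r m) \<bullet> D k (\<xi> (r m)) = 0"
      using eventually_ge_at_top[of k]
      by eventually_elim (use \<xi>(2) seq_suble[OF r] order_trans in blast)
    then have "(\<lambda>m. y (r m) \<bullet> D k (\<xi> (r m))) \<longlonglongrightarrow> 0"
      by (simp add: tendsto_eventually)
    ultimately show ?thesis
      by (rule LIMSEQ_unique)
  qed
  then obtain e where "e > 0" "\<forall>t. \<bar>t - \<tau>\<bar> < e \<longrightarrow> x \<bullet> g t = 0"
    using real_analytic_locally_zero[OF xg, of x \<tau>] D by auto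
  then have "\<forall>t. x \<bullet> g t = 0"
    using real_analytic_identity[OF xg] by blast
  then have "x = 0" using indep by simp
  then show False using x by simp
qed

section \<open>Good blocks for all but countably many periods\<close>

text \<open>Exactly the hypotheses of \<open>drift_free_steer\<close> for the block starting at
  \<open>k\<close>, bundled because they must all hold at one and the same period.\<close>

definition good_block :: "(int \<Rightarrow> real^'n) \<Rightarrow> (int \<Rightarrow> real^'n) \<Rightarrow> nat \<Rightarrow> int \<Rightarrow> bool" where
  "good_block \<beta> \<gamma> K k \<longleftrightarrow>
    (\<forall>i\<in>{..<3*K}. \<forall>j\<in>{..<3*K}. \<gamma> (k + int i) \<bullet> \<beta> (k + int j) \<noteq> 0) \<and>
    (\<forall>x. (\<forall>l\<in>{0..<K}. x \<bullet> \<gamma> (k + int l) = 0) \<longrightarrow> x = 0) \<and>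
    (\<forall>x. (\<forall>l\<in>{K..<2*K}. x \<bullet> \<beta> (k + int l) = 0) \<longrightarrow> x = 0) \<and>
    (\<forall>x. (\<forall>l\<in>{2*K..<3*K}. x \<bullet> \<beta> (k + int l) = 0) \<longrightarrow> x = 0)"

lemma good_block_steer:
  assumes "good_block \<beta> \<gamma> K k"
  shows "\<exists>F. dt_traj (\<lambda>_. mat 1) \<beta> \<gamma> F k (3*K) z = 0"
  using assms unfolding good_block_def by (intro drift_free_steer) auto

lemma countable_not_good_block:
  fixes \<beta> \<gamma> :: "real \<Rightarrow> int \<Rightarrow> real^'n"
  assumes \<beta>: "\<And>j. analytic_vec (\<lambda>\<delta>. \<beta> \<delta> j)" and \<gamma>: "\<And>j. analytic_vec (\<lambda>\<delta>. \<gamma> \<delta> j)"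
    and good: "good_block (\<beta> \<delta>0) (\<gamma> \<delta>0) K k"
  shows "countable {\<delta>. \<not> good_block (\<beta> \<delta>) (\<gamma> \<delta>) K k}"
proof -
  define Z1 where "Z1 = (\<Union>i\<in>{..<3*K}. \<Union>j\<in>{..<3*K}. {\<delta>. \<gamma> \<delta> (k + int i) \<bullet> \<beta> \<delta> (k + int j) = 0})"
  define Z2 where "Z2 v I = {\<delta>. \<exists>x. x \<noteq> 0 \<and> (\<forall>l\<in>I. x \<bullet> v \<delta> (k + int l) = 0)}"
    for v :: "real \<Rightarrow> int \<Rightarrow> real^'n" and I
  have "countable {\<delta>. \<gamma> \<delta> (k + int i) \<bullet> \<beta> \<delta> (k + int j) = 0}"
    if "i \<in> {..<3*K}" "j \<in> {..<3*K}" for i j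
    using that good unfolding good_block_def
    by (intro countable_zeros_real_analytic[of _ \<delta>0] real_analytic_inner \<beta> \<gamma>) simp
  then have "countable Z1"
    unfolding Z1_def by (intro countable_UN) auto
  moreover have "countable (Z2 \<gamma> {0..<K})"
    unfolding Z2_def
    by (rule countable_not_spanning[of _ _ \<delta>0]) (use good \<gamma> in \<open>simp_all add: good_block_def\<close>)
  moreover have "countable (Z2 \<beta> {K..<2*K})"
    unfolding Z2_def
    by (rule countable_not_spanning[of _ _ \<delta>0]) (use good \<beta> in \<open>simp_all add: good_block_def\<close>)
  moreover have "countable (Z2 \<beta> {2*K..<3*K})"
    unfolding Z2_def
    by (rule countable_not_spanning[of _ _ \<delta>0]) (use good \<beta> in \<open>simp_all add: good_block_def\<close>)
  ultimately have "countable (Z1 \<union> Z2 \<gamma> {0..<K} \<union> Z2 \<beta> {K..<2*K} \<union> Z2 \<beta> {2*K..<3*K})"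
    by simp
  moreover have "{\<delta>. \<not> good_block (\<beta> \<delta>) (\<gamma> \<delta>) K k}
      \<subseteq> Z1 \<union> Z2 \<gamma> {0..<K} \<union> Z2 \<beta> {K..<2*K} \<union> Z2 \<beta> {2*K..<3*K}"
    unfolding good_block_def Z1_def Z2_def by blast
  ultimately show ?thesis
    using countable_subset by blast
qed

lemma has_real_derivative_inner_left:
  assumes "(B has_vector_derivative B') (at t)"
  shows "((\<lambda>t. x \<bullet> B t) has_real_derivative x \<bullet> B') (at t)"
  unfolding has_real_derivative_iff_has_vector_derivative
  by (rule bounded_linear.has_vector_derivative[OF bounded_linear_inner_right assms])

text \<open>Replaces an input increment by a value of \<open>\<beta>\<close>: if \<open>x\<close>
  annihilates an increment of \<open>B\<close>, then \<open>x \<bullet> \<beta>\<close> has a zero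
  inside that interval. The point \<open>z\<close> depends on \<open>x\<close>.\<close>

lemma inner_increment_mean_value:
  assumes "\<And>t. (B has_vector_derivative \<beta> t) (at t)" and "a < b"
  shows "\<exists>z. a < z \<and> z < b \<and> x \<bullet> (B b - B a) = (b - a) * (x \<bullet> \<beta> z)"
  using MVT2[of a b "\<lambda>t. x \<bullet> B t" "\<lambda>t. x \<bullet> \<beta> t"] assms
  by (auto simp: inner_diff_right intro: has_real_derivative_inner_left)

text \<open>The sampling period \<open>\<tau> / (3 K m)\<close> puts the first instant of block \<open>m\<close> at \<open>\<tau>\<close>, and
  the whole block close to \<open>\<tau>\<close> if \<open>\<bar>m\<bar>\<close> is large.\<close>
lemma good_block_exists:
  fixes \<beta> \<gamma> B :: "real \<Rightarrow> real^'n"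
  assumes \<beta>: "analytic_vec \<beta>" "\<forall>x. (\<forall>t. x \<bullet> \<beta> t = 0) \<longrightarrow> x = 0"
    and \<gamma>: "analytic_vec \<gamma>" "\<forall>x. (\<forall>t. x \<bullet> \<gamma> t = 0) \<longrightarrow> x = 0"
    and B: "\<And>t. (B has_vector_derivative \<beta> t) (at t)"
    and nz: "\<gamma> \<tau> \<bullet> \<beta> \<tau> \<noteq> 0"
  shows "\<exists>K0. \<forall>K\<ge>K0. K > 0 \<longrightarrow> (\<exists>M::nat. \<forall>m::int. int M \<le> \<bar>m\<bar> \<longrightarrow> real_of_int m * \<tau> > 0 \<longrightarrow>
    (\<exists>\<delta>. good_block (\<lambda>j. B (of_int (j + 1) * \<delta>) - B (of_int j * \<delta>)) (\<lambda>j. \<gamma> (of_int j * \<delta>)) K (3 * int K * m)))"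
proof -
  obtain K1 \<eta>1 where \<eta>1: "\<eta>1 > 0" and *: "\<forall>K\<ge>K1. \<forall>x p. (\<forall>l<K. \<bar>p l - \<tau>\<bar> < \<eta>1 \<and> x \<bullet> \<beta> (p l) = 0) \<longrightarrow>
      (\<forall>l. Suc l < K \<longrightarrow> p l < p (Suc l)) \<longrightarrow> x = 0"
    using analytic_vec_spanning_near[OF \<beta>, of \<tau>] by (elim exE conjE)
  have K1: "x = 0" if "K1 \<le> K" "\<forall>l<K. \<bar>p l - \<tau>\<bar> < \<eta>1 \<and> x \<bullet> \<beta> (p l) = 0"
    "\<forall>l. Suc l < K \<longrightarrow> p l < p (Suc l)" for K x p
    using * that by simp
  obtain K2 \<eta>2 where \<eta>2: "\<eta>2 > 0" and *: "\<forall>K\<ge>K2. \<forall>x p. (\<forall>l<K. \<bar>p l - \<tau>\<bar> < \<eta>2 \<and> x \<bullet> \<gamma> (p l) = 0) \<longrightarrow>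
      (\<forall>l. Suc l < K \<longrightarrow> p l < p (Suc l)) \<longrightarrow> x = 0"
    using analytic_vec_spanning_near[OF \<gamma>, of \<tau>] by (elim exE conjE)
  have K2: "x = 0" if "K2 \<le> K" "\<forall>l<K. \<bar>p l - \<tau>\<bar> < \<eta>2 \<and> x \<bullet> \<gamma> (p l) = 0"
    "\<forall>l. Suc l < K \<longrightarrow> p l < p (Suc l)" for K x p
    using * that by simp
  obtain \<eta>3 where \<eta>3: "\<eta>3 > 0" "\<And>s t. \<bar>t - \<tau>\<bar> < \<eta>3 \<Longrightarrow> \<bar>s - \<tau>\<bar> < \<eta>3 \<Longrightarrow> \<gamma> t \<bullet> \<beta> s \<noteq> 0"
  proof -
    \<comment> \<open>Joint continuity is required: outputs and inputs of a block are paired at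
      different times.\<close>
    have "continuous_on UNIV (\<lambda>p. \<gamma> (fst p) \<bullet> \<beta> (snd p))"
      by (intro continuous_on_inner continuous_on_compose2[OF analytic_vec_continuous[of _ UNIV]] \<beta> \<gamma>
          continuous_intros) auto
    then have "isCont (\<lambda>p. \<gamma> (fst p) \<bullet> \<beta> (snd p)) (\<tau>, \<tau>)"
      by (simp add: continuous_on_eq_continuous_at)
    then obtain e where e: "e > 0" "\<forall>p. dist (\<tau>, \<tau>) p < e \<longrightarrow> \<gamma> (fst p) \<bullet> \<beta> (snd p) \<noteq> 0"
      using continuous_at_avoid[of "(\<tau>, \<tau>)" "\<lambda>p. \<gamma> (fst p) \<bullet> \<beta> (snd p)" 0] nz by auto
    have "\<gamma> t \<bullet> \<beta> s \<noteq> 0" if "\<bar>t - \<tau>\<bar> < e / 2" "\<bar>s - \<tau>\<bar> < e / 2" for s t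
    proof -
      have "dist (\<tau>, \<tau>) (t, s) \<le> \<bar>t - \<tau>\<bar> + \<bar>s - \<tau>\<bar>"
        using sqrt_sum_squares_le_sum_abs[of "\<tau> - t" "\<tau> - s"]
        by (simp add: dist_Pair_Pair dist_real_def abs_minus_commute)
      then show ?thesis
        using e(2) that by force
    qed
    then show ?thesis
      using that[of "e / 2"] e(1) by simp
  qed
  define \<eta> where "\<eta> = min \<eta>1 (min \<eta>2 \<eta>3)"
  have \<eta>: "\<eta> > 0" "\<eta> \<le> \<eta>1" "\<eta> \<le> \<eta>2" "\<eta> \<le> \<eta>3"
    using \<eta>1 \<eta>2 \<eta>3(1) by (auto simp: \<eta>_def)
  define M where "M = Suc (nat \<lceil>\<bar>\<tau>\<bar> / \<eta>\<rceil>)"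
  show ?thesis
  proof (rule exI[of _ "max K1 K2"], intro allI impI, rule exI[of _ M], intro allI impI)
    fix K :: nat and m :: int
    assume K: "max K1 K2 \<le> K" "K > 0" and m: "int M \<le> \<bar>m\<bar>" "real_of_int m * \<tau> > 0"
    \<comment> \<open>Positive since \<open>m\<close> and \<open>\<tau>\<close> have the same sign.
      The block starts at \<open>t 0 = \<tau>\<close> and lasts
      \<open>\<bar>\<tau>\<bar> / \<bar>m\<bar>\<close>, which the choice of \<open>M\<close> makes
      smaller than \<open>\<eta>\<close>.\<close>
    define \<delta> where "\<delta> = \<tau> / (3 * real K * of_int m)"
    define t where "t l = \<tau> + real l * \<delta>" for l
    have m0: "m \<noteq> 0"
      using m(2) by auto
    have "\<delta> = (real_of_int m * \<tau>) / (3 * real K * (of_int m)\<^sup>2)"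
      using m0 K(2) by (simp add: \<delta>_def power2_eq_square)
    also have "\<dots> > 0"
      by (rule divide_pos_pos[OF m(2)]) (use m0 K(2) in simp)
    finally have \<delta>: "\<delta> > 0" .
    have t: "of_int (3 * int K * m + int l) * \<delta> = t l" for l
      using m0 K(2) by (simp add: t_def \<delta>_def field_simps)
    have t': "of_int (3 * int K * m + int l + 1) * \<delta> = t (Suc l)" for l
      using t[of "Suc l"] by (simp add: algebra_simps)
    have t_less: "t l < t l'" if "l < l'" for l l'
      using that \<delta> by (simp add: t_def)
    have near: "\<bar>s - \<tau>\<bar> < \<eta>" if "t 0 \<le> s" "s \<le> t (3*K)" for s
    proof -
      have "\<bar>s - \<tau>\<bar> \<le> 3 * real K * \<delta>"
        using that \<delta> by (simp add: t_def)
      also have "3 * real K * \<delta> = \<bar>\<tau>\<bar> / real_of_int \<bar>m\<bar>"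
      proof -
        have "3 * real K * \<delta> = \<tau> / of_int m"
          using K(2) by (simp add: \<delta>_def)
        moreover have "0 \<le> 3 * real K * \<delta>"
          using \<delta> by simp
        ultimately have "3 * real K * \<delta> = \<bar>\<tau> / of_int m\<bar>"
          by (simp only: abs_of_nonneg)
        then show ?thesis
          by (simp only: abs_divide of_int_abs)
      qed
      also have "\<bar>\<tau>\<bar> / real_of_int \<bar>m\<bar> < \<eta>"
      proof -
        have "\<bar>\<tau>\<bar> / \<eta> < real M"
          unfolding M_def by linarith
        also have "real M \<le> real_of_int \<bar>m\<bar>"
          using m(1) by linarith
        finally show ?thesis
          using m0 \<eta>(1) by (simp add: field_simps)
      qed
      finally show ?thesis .
    qed
    have t_near: "\<bar>t l - \<tau>\<bar> < \<eta>" if "l \<le> 3*K" for l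
      using that \<delta> by (intro near) (auto simp: t_def intro!: mult_right_mono)
    have betw_near: "\<bar>z - \<tau>\<bar> < \<eta>" if "t l < z" "z < t (Suc l)" "l < 3*K" for z l
      using that \<delta> t_less[of 0 l] t_less[of "Suc l" "3*K"]
      by (intro near) (cases "l = 0"; cases "Suc l = 3*K"; force)+
    have \<beta>_span: "x = 0" if x: "\<forall>l\<in>{L..<L+K}. x \<bullet> (B (t (Suc l)) - B (t l)) = 0" and L: "L + K \<le> 3*K" for x L
    proof -
      \<comment> \<open>The mean value points lie in consecutive sampling intervals, hence are
        strictly increasing zeros of \<open>x \<bullet> \<beta>\<close> near
        \<open>\<tau>\<close>.\<close>
      have "\<exists>z. l < K \<longrightarrow> t (L + l) < z \<and> z < t (Suc (L + l)) \<and> x \<bullet> \<beta> z = 0" for l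
        using inner_increment_mean_value[OF B t_less[of "L + l" "Suc (L + l)"], of x] x t_less[of "L + l" "Suc (L + l)"]
        by fastforce
      then have "\<forall>l. \<exists>z. l < K \<longrightarrow> t (L + l) < z \<and> z < t (Suc (L + l)) \<and> x \<bullet> \<beta> z = 0" ..
      from choice[OF this] obtain p where p: "\<forall>l. l < K \<longrightarrow> t (L + l) < p l \<and> p l < t (Suc (L + l)) \<and> x \<bullet> \<beta> (p l) = 0" ..
      show "x = 0"
      proof (rule K1[of K p])
        show "\<forall>l<K. \<bar>p l - \<tau>\<bar> < \<eta>1 \<and> x \<bullet> \<beta> (p l) = 0"
        proof (intro allI impI)
          fix l assume "l < K"
          then show "\<bar>p l - \<tau>\<bar> < \<eta>1 \<and> x \<bullet> \<beta> (p l) = 0"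
            using p betw_near[of "L + l" "p l"] L \<eta>(2) by auto
        qed
        show "\<forall>l. Suc l < K \<longrightarrow> p l < p (Suc l)"
        proof (intro allI impI)
          fix l assume "Suc l < K"
          then have "p l < t (Suc (L + l))" "t (L + Suc l) < p (Suc l)"
            using p by auto
          then show "p l < p (Suc l)" by simp
        qed
      qed (use K in simp)
    qed
    have "good_block (\<lambda>j. B (of_int (j + 1) * \<delta>) - B (of_int j * \<delta>)) (\<lambda>j. \<gamma> (of_int j * \<delta>)) K (3 * int K * m)"
      unfolding good_block_def t t'
    proof (intro conjI ballI allI impI)
      fix i j assume "i \<in> {..<3*K}" "j \<in> {..<3*K}"
      then have i: "i < 3*K" and j: "j < 3*K" by auto
      obtain z where z: "t j < z" "z < t (Suc j)"
        "\<gamma> (t i) \<bullet> (B (t (Suc j)) - B (t j)) = (t (Suc j) - t j) * (\<gamma> (t i) \<bullet> \<beta> z)"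
        using inner_increment_mean_value[OF B t_less[of j "Suc j"]] by blast
      have "\<gamma> (t i) \<bullet> \<beta> z \<noteq> 0"
        using t_near[of i] betw_near[OF z(1,2) j] i \<eta>(4) by (intro \<eta>3(2)) auto
      then show "\<gamma> (t i) \<bullet> (B (t (Suc j)) - B (t j)) \<noteq> 0"
        using z t_less[of j "Suc j"] by simp
    next
      fix x assume x: "\<forall>l\<in>{0..<K}. x \<bullet> \<gamma> (t l) = 0"
      show "x = 0"
      proof (rule K2[of K t])
        show "\<forall>l<K. \<bar>t l - \<tau>\<bar> < \<eta>2 \<and> x \<bullet> \<gamma> (t l) = 0"
        proof (intro allI impI)
          fix l assume "l < K"
          then show "\<bar>t l - \<tau>\<bar> < \<eta>2 \<and> x \<bullet> \<gamma> (t l) = 0"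
            using x t_near[of l] \<eta>(3) by auto
        qed
      qed (use K t_less in auto)
    next
      fix x assume "\<forall>l\<in>{K..<2*K}. x \<bullet> (B (t (Suc l)) - B (t l)) = 0"
      then show "x = 0" by (intro \<beta>_span[of K]) auto
    next
      fix x assume "\<forall>l\<in>{2*K..<3*K}. x \<bullet> (B (t (Suc l)) - B (t l)) = 0"
      then show "x = 0" by (intro \<beta>_span[of "2*K"]) auto
    qed
    then show "\<exists>\<delta>. good_block (\<lambda>j. B (of_int (j + 1) * \<delta>) - B (of_int j * \<delta>)) (\<lambda>j. \<gamma> (of_int j * \<delta>)) K (3 * int K * m)" ..
  qed
qed

text \<open>Groups \<open>CARD('n)\<close> consecutive good blocks into one nullifying superblock.
  Superblock \<open>q\<close> consists of the blocks \<open>CARD('n) * q + p\<close>, whose indices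
  are still at least \<open>M\<close> in absolute value if \<open>q \<ge> M\<close> or
  \<open>q < -M\<close>.\<close>

lemma unif_nullifiable_good_blocks:
  fixes \<beta> \<gamma> :: "int \<Rightarrow> real^'n" and M :: nat
  assumes "K > 0" and good: "\<And>m. int M \<le> \<bar>m\<bar> \<Longrightarrow> good_block \<beta> \<gamma> K (3 * int K * m)"
  shows "unif_nullifiable (\<lambda>_. mat 1) \<beta> \<gamma>"
proof (rule unif_nullifiable_blocks[where L = "3 * K * CARD('n)" and M = M])
  fix q :: int assume q: "q \<ge> int M \<or> q < - int M"
  have "\<exists>F. dt_traj (\<lambda>_. mat 1) \<beta> \<gamma> F (int (3*K * CARD('n)) * q + int (3*K * p)) (3*K) z = 0"
    if p: "p < CARD('n)" for p z
  proof -
    let ?m = "int CARD('n) * q + int p"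
    have "int M \<le> \<bar>?m\<bar>"
    proof (cases "q \<ge> 0")
      case True
      then have "q \<le> int CARD('n) * q"
        using mult_right_mono[of 1 "int CARD('n)" q] by simp
      then show ?thesis using q True by linarith
    next
      case False
      then have "int CARD('n) * (q + 1) \<le> q + 1"
        using mult_right_mono_neg[of 1 "int CARD('n)" "q + 1"] by simp
      then have "?m < q + 1"
        using p by (simp add: algebra_simps)
      then show ?thesis using q False by linarith
    qed
    then have "good_block \<beta> \<gamma> K (3 * int K * ?m)"
      by (rule good)
    moreover have "3 * int K * ?m = int (3*K * CARD('n)) * q + int (3*K * p)"
      by (simp add: algebra_simps)
    ultimately show ?thesis
      using good_block_steer by metis
  qed
  then show "\<exists>F. \<forall>x. dt_traj (\<lambda>_. mat 1) \<beta> \<gamma> F (int (3*K * CARD('n)) * q) (3*K * CARD('n)) x = 0"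
    by (rule dt_traj_kill_all)
qed (use assms(1) in simp)

text \<open>All sufficiently late and all sufficiently early blocks are good; the blocks in between are
  absorbed in the nullification time.\<close>
lemma countable_not_nullifiable_drift_free:
  fixes \<beta> \<gamma> B :: "real \<Rightarrow> real^'n"
  assumes \<beta>: "analytic_vec \<beta>" "\<forall>x. (\<forall>t. x \<bullet> \<beta> t = 0) \<longrightarrow> x = 0"
    and \<gamma>: "analytic_vec \<gamma>" "\<forall>x. (\<forall>t. x \<bullet> \<gamma> t = 0) \<longrightarrow> x = 0"
    and B: "\<And>t. (B has_vector_derivative \<beta> t) (at t)"
    and nz: "\<gamma> \<tau> \<bullet> \<beta> \<tau> \<noteq> 0"
  shows "countable {\<delta>. \<not> unif_nullifiable (\<lambda>_. mat 1)
    (\<lambda>j. B (of_int (j + 1) * \<delta>) - B (of_int j * \<delta>)) (\<lambda>j. \<gamma> (of_int j * \<delta>))}"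
proof -
  define bb where "bb \<delta> j = B (of_int (j + 1) * \<delta>) - B (of_int j * \<delta>)" for \<delta> and j :: int
  define gg where "gg \<delta> j = \<gamma> (of_int j * \<delta>)" for \<delta> and j :: int
  have zeros: "countable {t. \<gamma> t \<bullet> \<beta> t = 0}"
    by (rule countable_zeros_real_analytic[OF real_analytic_inner[OF \<gamma>(1) \<beta>(1)] nz])
  have "\<exists>t\<in>S. \<gamma> t \<bullet> \<beta> t \<noteq> 0" if "uncountable S" for S
    using that zeros countable_subset[of S "{t. \<gamma> t \<bullet> \<beta> t = 0}"] by blast
  \<comment> \<open>One point on each side of 0: late blocks are squeezed near
    \<open>\<tau>1\<close> and early ones near \<open>\<tau>2\<close>, in both cases by a positive
    period.\<close>
  from this[of "{0<..<1}"] this[of "{-1<..<0}"]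
  obtain \<tau>1 \<tau>2 where \<tau>: "\<tau>1 > 0" "\<gamma> \<tau>1 \<bullet> \<beta> \<tau>1 \<noteq> 0" "\<tau>2 < 0" "\<gamma> \<tau>2 \<bullet> \<beta> \<tau>2 \<noteq> 0"
    by (auto simp: uncountable_open_interval)
  obtain K1 where K1: "\<forall>K\<ge>K1. K > 0 \<longrightarrow> (\<exists>M::nat. \<forall>m::int. int M \<le> \<bar>m\<bar> \<longrightarrow> real_of_int m * \<tau>1 > 0 \<longrightarrow>
      (\<exists>\<delta>. good_block (bb \<delta>) (gg \<delta>) K (3 * int K * m)))"
    using good_block_exists[OF \<beta> \<gamma> B \<tau>(2)] unfolding bb_def gg_def ..
  obtain K2 where K2: "\<forall>K\<ge>K2. K > 0 \<longrightarrow> (\<exists>M::nat. \<forall>m::int. int M \<le> \<bar>m\<bar> \<longrightarrow> real_of_int m * \<tau>2 > 0 \<longrightarrow>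
      (\<exists>\<delta>. good_block (bb \<delta>) (gg \<delta>) K (3 * int K * m)))"
    using good_block_exists[OF \<beta> \<gamma> B \<tau>(4)] unfolding bb_def gg_def ..
  define K where "K = Suc (max K1 K2)"
  have K: "K \<ge> K1" "K \<ge> K2" "K > 0"
    by (auto simp: K_def)
  obtain M1 :: nat where M1: "\<forall>m::int. int M1 \<le> \<bar>m\<bar> \<longrightarrow> real_of_int m * \<tau>1 > 0 \<longrightarrow>
      (\<exists>\<delta>. good_block (bb \<delta>) (gg \<delta>) K (3 * int K * m))"
    using K1 K by blast
  obtain M2 :: nat where M2: "\<forall>m::int. int M2 \<le> \<bar>m\<bar> \<longrightarrow> real_of_int m * \<tau>2 > 0 \<longrightarrow>
      (\<exists>\<delta>. good_block (bb \<delta>) (gg \<delta>) K (3 * int K * m))"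
    using K2 K by blast
  \<comment> \<open>The successor excludes the index 0, so every remaining block has a sign.\<close>
  define M where "M = Suc (max M1 M2)"
  have ex: "\<exists>\<delta>. good_block (bb \<delta>) (gg \<delta>) K (3 * int K * m)" if m: "int M \<le> \<bar>m\<bar>" for m
  proof (cases "m > 0")
    case True
    then show ?thesis
      using M1 m \<tau>(1) by (auto simp: M_def)
  next
    case False
    then have "m < 0" using m by (auto simp: M_def)
    then show ?thesis
      using M2 m \<tau>(3) by (auto simp: M_def mult_neg_neg)
  qed
  have "analytic_vec B"
    using \<beta>(1) B unfolding analytic_vec_def has_vector_derivative_cart_iff
    by (auto intro: real_analytic_antiderivative)
  then have an: "analytic_vec (\<lambda>\<delta>. bb \<delta> j)" "analytic_vec (\<lambda>\<delta>. gg \<delta> j)" for j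
    unfolding bb_def gg_def using \<gamma>(1)
    by (intro analytic_vec_diff analytic_vec_scale_argument; simp)+
  define E where "E = (\<Union>m\<in>{m. int M \<le> \<bar>m\<bar>}. {\<delta>. \<not> good_block (bb \<delta>) (gg \<delta>) K (3 * int K * m)})"
  have "countable E"
    unfolding E_def
  proof (intro countable_UN)
    fix m assume "m \<in> {m. int M \<le> \<bar>m\<bar>}"
    then obtain \<delta>0 where "good_block (bb \<delta>0) (gg \<delta>0) K (3 * int K * m)"
      using ex by blast
    then show "countable {\<delta>. \<not> good_block (bb \<delta>) (gg \<delta>) K (3 * int K * m)}"
      by (rule countable_not_good_block[OF an])
  qed simp
  moreover have "unif_nullifiable (\<lambda>_. mat 1) (bb \<delta>) (gg \<delta>)" if "\<delta> \<notin> E" for \<delta>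
    using that unfolding E_def by (intro unif_nullifiable_good_blocks[OF K(3), of M]) blast
  then have "{\<delta>. \<not> unif_nullifiable (\<lambda>_. mat 1) (bb \<delta>) (gg \<delta>)} \<subseteq> E"
    by blast
  ultimately have "countable {\<delta>. \<not> unif_nullifiable (\<lambda>_. mat 1) (bb \<delta>) (gg \<delta>)}"
    using countable_subset by blast
  then show ?thesis
    by (simp only: bb_def[abs_def] gg_def[abs_def])
qed

section \<open>Transition matrices and sampling\<close>

lemma bounded_linear_matrix_vector_mult_left: "bounded_linear (\<lambda>M :: real^'n^'m. M *v x)"
  unfolding linear_conv_bounded_linear[symmetric]
  by (simp add: linear_iff matrix_vector_mult_add_rdistrib scaleR_matrix_vector_assoc)

lemma transition_matrix_solution:
  assumes "transition_matrix A \<Phi>"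
  shows "((\<lambda>t. \<Phi> t s *v x) has_vector_derivative A t *v (\<Phi> t s *v x)) (at t)"
  using bounded_linear.has_vector_derivative[OF bounded_linear_matrix_vector_mult_left[of x],
      of "\<lambda>t. \<Phi> t s" "A t ** \<Phi> t s"] assms
  by (simp add: transition_matrix_def matrix_vector_mul_assoc)

lemma transition_matrix_id: "transition_matrix A \<Phi> \<Longrightarrow> \<Phi> s s = mat 1"
  by (simp add: transition_matrix_def)

text \<open>Applied to a vector, both sides solve the equation in \<open>t\<close> and agree at
  \<open>t = s\<close>; uniqueness is used on an interval containing \<open>s\<close> and
  \<open>t\<close>.\<close>

lemma transition_matrix_cocycle:
  assumes A: "analytic_mat A" and \<Phi>: "transition_matrix A \<Phi>"
  shows "\<Phi> t s ** \<Phi> s r = \<Phi> t r"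
proof -
  have "\<Phi> t s *v (\<Phi> s r *v x) - \<Phi> t r *v x = 0" for x
  proof (rule linear_ode_zero[OF analytic_mat_continuous[OF A], of "min s t - 1" "max s t + 1"
        "\<lambda>t. \<Phi> t s *v (\<Phi> s r *v x) - \<Phi> t r *v x" s])
    show "((\<lambda>t. \<Phi> t s *v (\<Phi> s r *v x) - \<Phi> t r *v x) has_vector_derivative
        A t *v (\<Phi> t s *v (\<Phi> s r *v x) - \<Phi> t r *v x)) (at t)" for t
      unfolding matrix_vector_mult_diff_distrib
      by (intro has_vector_derivative_diff transition_matrix_solution[OF \<Phi>])
  qed (use transition_matrix_id[OF \<Phi>] in auto)
  then show ?thesis
    unfolding matrix_eq by (simp add: matrix_vector_mul_assoc[symmetric])
qed

lemma transition_matrix_invertible: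
  assumes "analytic_mat A" "transition_matrix A \<Phi>"
  shows "invertible (\<Phi> t s)"
  unfolding invertible_def
  using transition_matrix_cocycle[OF assms] transition_matrix_id[OF assms(2)]
  by (intro exI[of _ "\<Phi> s t"]) simp

lemma analytic_transition_matrix:
  assumes "analytic_mat A" "transition_matrix A \<Phi>"
  shows "analytic_mat (\<lambda>t. \<Phi> t s)"
proof -
  have "analytic_vec (\<lambda>t. \<Phi> t s *v axis j 1)" for j
    by (rule analytic_linear_ode[OF assms(1) transition_matrix_solution[OF assms(2)]])
  then show ?thesis
    by (simp add: analytic_vec_def analytic_mat_def matrix_vector_mul_component inner_axis)
qed

text \<open>\<open>\<Phi> r s\<close> is the inverse of \<open>\<Phi> s r\<close>, which is analytic
  in \<open>s\<close>; Cramer's rule writes its product with \<open>b s\<close> as quotients of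
  analytic determinants.\<close>

lemma analytic_transition_matrix_pullback:
  assumes A: "analytic_mat A" and \<Phi>: "transition_matrix A \<Phi>" and b: "analytic_vec b"
  shows "analytic_vec (\<lambda>s. \<Phi> r s *v b s)"
proof -
  let ?N = "\<lambda>k s. \<chi> i j. if j = k then b s $ i else \<Phi> s r $ i $ j"
  have \<Phi>an: "analytic_mat (\<lambda>t. \<Phi> t r)"
    by (rule analytic_transition_matrix[OF A \<Phi>])
  have nz: "det (\<Phi> s r) \<noteq> 0" for s
    using transition_matrix_invertible[OF A \<Phi>] invertible_det_nz by blast
  have "\<Phi> s r *v (\<Phi> r s *v b s) = b s" for s
    by (simp add: matrix_vector_mul_assoc transition_matrix_cocycle[OF A \<Phi>] transition_matrix_id[OF \<Phi>])
  then have eq: "(\<Phi> r s *v b s) $ k = det (?N k s) * inverse (det (\<Phi> s r))" for s k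
    using cramer[OF nz[of s], of "\<Phi> r s *v b s" "b s"] by (simp add: divide_inverse)
  have "analytic_mat (?N k)" for k
    unfolding analytic_mat_def
  proof (intro allI)
    fix i j
    show "real_analytic (\<lambda>t. ?N k t $ i $ j)"
      using \<Phi>an b by (cases "j = k") (simp_all add: analytic_mat_def analytic_vec_def)
  qed
  then show ?thesis
    unfolding analytic_vec_def eq
    by (intro allI real_analytic_mult real_analytic_det real_analytic_inverse nz \<Phi>an)
qed

section \<open>Controllability and the drift-free sampled system\<close>

text \<open>Steering from 0 to \<open>\<Phi> t1 0 *v x\<close> and pulling back to time 0 writes
  \<open>x\<close> as an integral of multiples of \<open>\<Phi> 0 s *v b s\<close>. If
  \<open>x\<close> is orthogonal to all of these, then \<open>x \<bullet> x = 0\<close>.\<close>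

lemma controllable_pullback_independent:
  assumes A: "analytic_mat A" and \<Phi>: "transition_matrix A \<Phi>" and "controllable \<Phi> b"
    and x: "\<forall>t. x \<bullet> (\<Phi> 0 t *v b t) = 0"
  shows "x = 0"
proof -
  obtain t1 where "t1 > 0" "controllable_on \<Phi> b 0 t1"
    using assms(3) unfolding controllable_def by blast
  then obtain u where u: "((\<lambda>s. u s *\<^sub>R (\<Phi> t1 s *v b s)) has_integral (\<Phi> t1 0 *v x - \<Phi> t1 0 *v 0)) {0..t1}"
    unfolding controllable_on_def by blast
  have "bounded_linear (\<lambda>z. x \<bullet> (\<Phi> 0 t1 *v z))"
    by (intro bounded_linear_compose[OF bounded_linear_inner_right] matrix_vector_mul_bounded_linear)
  from has_integral_linear[OF u this]
  have "((\<lambda>s. u s * (x \<bullet> (\<Phi> 0 t1 *v (\<Phi> t1 s *v b s)))) has_integral x \<bullet> (\<Phi> 0 t1 *v (\<Phi> t1 0 *v x))) {0..t1}"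
    by (simp add: o_def matrix_vector_mult_scaleR)
  then have "((\<lambda>s. 0) has_integral x \<bullet> x) {0..t1}"
    using x by (simp add: matrix_vector_mul_assoc transition_matrix_cocycle[OF A \<Phi>] transition_matrix_id[OF \<Phi>])
  then have "x \<bullet> x = 0"
    using has_integral_unique has_integral_0 by blast
  then show ?thesis by simp
qed

text \<open>In the coordinates \<open>T j = \<Phi> (j \<delta>) 0\<close> the cocycle law turns the
  drift into the identity, and the fundamental theorem of calculus turns the sampled input into an
  increment of \<open>B\<close>.\<close>

lemma sample_nullifiable_drift_free:
  assumes A: "analytic_mat A" and \<Phi>: "transition_matrix A \<Phi>" and b: "analytic_vec b"
    and B: "\<And>t. (B has_vector_derivative \<Phi> 0 t *v b t) (at t)" and "\<delta> > 0"
    and null: "unif_nullifiable (\<lambda>_. mat 1) (\<lambda>j. B (of_int (j + 1) * \<delta>) - B (of_int j * \<delta>))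
      (\<lambda>j. transpose (\<Phi> (of_int j * \<delta>) 0) *v c (of_int j * \<delta>))"
  shows "sample_nullifiable \<Phi> b c \<delta>"
  unfolding sample_nullifiable_def
proof (rule unif_nullifiable_change_coordinates[where T = "\<lambda>j. \<Phi> (of_int j * \<delta>) 0", OF _ _ _ _ null])
  fix j :: int
  let ?u = "of_int j * \<delta>" and ?v = "of_int (j + 1) * \<delta>"
  show "samp_A \<Phi> \<delta> j ** \<Phi> ?u 0 = \<Phi> ?v 0 ** mat 1"
    by (simp only: samp_A_def transition_matrix_cocycle[OF A \<Phi>] matrix_mul_rid)
  show "transpose (\<Phi> ?u 0) *v c ?u = transpose (\<Phi> ?u 0) *v samp_c c \<delta> j"
    by (simp add: samp_c_def)
  show "invertible (\<Phi> ?u 0)"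
    by (rule transition_matrix_invertible[OF A \<Phi>])
  have "((\<lambda>s. \<Phi> 0 s *v b s) has_integral (B ?v - B ?u)) {?u..?v}"
    by (rule fundamental_theorem_of_calculus, use \<open>\<delta> > 0\<close> in simp)
      (rule has_vector_derivative_at_within, rule B)
  then have "((\<lambda>s. \<Phi> ?v 0 *v (\<Phi> 0 s *v b s)) has_integral \<Phi> ?v 0 *v (B ?v - B ?u)) {?u..?v}"
    by (rule has_integral_linear[OF _ matrix_vector_mul_bounded_linear[of "\<Phi> ?v 0"], unfolded o_def])
  then show "samp_b \<Phi> b \<delta> j = \<Phi> ?v 0 *v (B ?v - B ?u)"
    unfolding samp_b_def
    by (simp only: matrix_vector_mul_assoc transition_matrix_cocycle[OF A \<Phi>] integral_unique)
qed

theorem theorem3: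
  fixes A :: "real \<Rightarrow> real^'n^'n"
    and b :: "real \<Rightarrow> real^'n"
    and \<Phi> :: "real \<Rightarrow> real \<Rightarrow> real^'n^'n"
  assumes "analytic_mat A"
    and "analytic_vec b"
    and "transition_matrix A \<Phi>"
    and "controllable \<Phi> b"
  shows "\<exists>S. S \<subseteq> {c. analytic_vec c} \<and> sup_open S \<and> sup_dense S \<and>
           (\<forall>c\<in>S. observable \<Phi> c \<longrightarrow>
              (\<exists>E :: real set. countable E \<and>
                 (\<forall>\<delta>>0. \<delta> \<notin> E \<longrightarrow> sample_nullifiable \<Phi> b c \<delta>)))"
proof -
  define S where "S = {c. analytic_vec c \<and> (\<exists>t. c t \<bullet> b t \<noteq> 0)}"
  define \<beta> where "\<beta> s = \<Phi> 0 s *v b s" for s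
  have \<beta>: "analytic_vec \<beta>"
    unfolding \<beta>_def by (rule analytic_transition_matrix_pullback[OF assms(1,3,2)])
  have \<beta>_indep: "\<forall>x. (\<forall>t. x \<bullet> \<beta> t = 0) \<longrightarrow> x = 0"
    using controllable_pullback_independent[OF assms(1,3,4)] unfolding \<beta>_def by blast
  \<comment> \<open>A primitive on the whole line is needed, as sampling also runs through negative
    times.\<close>
  have "\<exists>F. \<forall>x. -\<infinity> < ereal x \<longrightarrow> ereal x < \<infinity> \<longrightarrow> (F has_vector_derivative \<beta> x) (at x)"
  proof (rule einterval_antiderivative)
    show "isCont \<beta> x" for x
      using analytic_vec_continuous[OF \<beta>, of UNIV] by (simp add: continuous_on_eq_continuous_at)
  qed simp
  then obtain B where B: "\<And>t. (B has_vector_derivative \<beta> t) (at t)"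
    by auto
  have "sup_open S"
    unfolding sup_open_def
  proof
    fix c assume "c \<in> S"
    then obtain t where t: "c t \<bullet> b t \<noteq> 0"
      by (auto simp: S_def)
    \<comment> \<open>A perturbation of this size changes \<open>c t \<bullet> b t\<close> by at
      most half its absolute value.\<close>
    define \<epsilon> where "\<epsilon> = \<bar>c t \<bullet> b t\<bar> / (2 * norm (b t))"
    have bt: "norm (b t) > 0"
      using t by auto
    have "c' \<in> S" if c': "analytic_vec c'" "\<forall>t. norm (c' t - c t) \<le> \<epsilon>" for c'
    proof -
      have "\<bar>(c' t - c t) \<bullet> b t\<bar> \<le> norm (c' t - c t) * norm (b t)"
        by (rule Cauchy_Schwarz_ineq2)
      also have "\<dots> \<le> \<epsilon> * norm (b t)"
        using c' by (intro mult_right_mono) auto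
      also have "\<dots> < \<bar>c t \<bullet> b t\<bar>"
        using t bt by (simp add: \<epsilon>_def)
      finally have "c' t \<bullet> b t \<noteq> 0"
        by (auto simp: inner_diff_left)
      then show ?thesis
        using c' by (auto simp: S_def)
    qed
    moreover have "\<epsilon> > 0"
      using t bt by (simp add: \<epsilon>_def)
    ultimately show "\<exists>\<epsilon>>0. \<forall>c'. analytic_vec c' \<and> (\<forall>t. norm (c' t - c t) \<le> \<epsilon>) \<longrightarrow> c' \<in> S"
      by blast
  qed
  moreover have "sup_dense S"
    unfolding sup_dense_def
  proof (intro allI impI)
    fix c :: "real \<Rightarrow> real^'n" and \<epsilon> :: real assume c: "analytic_vec c" and "\<epsilon> > 0"
    show "\<exists>c'\<in>S. \<forall>t. norm (c' t - c t) \<le> \<epsilon>"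
    proof (cases "c \<in> S")
      case True
      then show ?thesis
        using \<open>\<epsilon> > 0\<close> by (intro bexI[of _ c]) auto
    next
      case False
      then have cb: "c t \<bullet> b t = 0" for t
        using c by (auto simp: S_def)
      \<comment> \<open>If \<open>b\<close> vanished identically, so would \<open>\<beta>\<close>,
        contradicting independence for any nonzero vector such as a unit vector.\<close>
      obtain t where t: "b t \<noteq> 0"
      proof (rule ccontr)
        assume "\<not> thesis"
        then have "b t = 0" for t
          using that by blast
        then have "\<beta> t = 0" for t
          by (simp add: \<beta>_def)
        then show False
          using spec[OF \<beta>_indep, of "axis undefined 1"] by (simp add: axis_eq_0_iff)
      qed
      \<comment> \<open>A constant shift of norm \<open>\<epsilon>\<close> along \<open>b t\<close>;
        since \<open>c t \<bullet> b t = 0\<close>, the new product at \<open>t\<close> is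
        \<open>\<epsilon> * norm (b t)\<close>.\<close>
      define v where "v = (\<epsilon> / norm (b t)) *\<^sub>R b t"
      have "analytic_vec (\<lambda>t. c t + v)"
        by (intro analytic_vec_add analytic_vec_const c)
      moreover have "(c t + v) \<bullet> b t \<noteq> 0"
        using t \<open>\<epsilon> > 0\<close> by (simp add: inner_add_left cb v_def)
      ultimately have "(\<lambda>t. c t + v) \<in> S"
        by (auto simp: S_def)
      then show ?thesis
        using t \<open>\<epsilon> > 0\<close> by (intro bexI[of _ "\<lambda>t. c t + v"]) (auto simp: v_def)
    qed
  qed
  moreover have "\<exists>E :: real set. countable E \<and> (\<forall>\<delta>>0. \<delta> \<notin> E \<longrightarrow> sample_nullifiable \<Phi> b c \<delta>)"
    if "c \<in> S" and obs: "observable \<Phi> c" for c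
  proof -
    define \<gamma> where "\<gamma> t = transpose (\<Phi> t 0) *v c t" for t
    have c: "analytic_vec c" and "\<exists>t. c t \<bullet> b t \<noteq> 0"
      using \<open>c \<in> S\<close> by (auto simp: S_def)
    then obtain \<tau> where \<tau>: "c \<tau> \<bullet> b \<tau> \<noteq> 0"
      by blast
    have \<gamma>: "\<gamma> t \<bullet> x = c t \<bullet> (\<Phi> t 0 *v x)" for t x
      unfolding \<gamma>_def by (simp add: dot_lmul_matrix[symmetric] flip: transpose_matrix_vector)
    \<comment> \<open>The pairing is invariant under the change of coordinates, so the condition
      defining \<open>S\<close> is the one required of \<open>\<gamma>\<close> and
      \<open>\<beta>\<close>.\<close>
    have "\<gamma> \<tau> \<bullet> \<beta> \<tau> = c \<tau> \<bullet> b \<tau>"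
      unfolding \<gamma> \<beta>_def
      by (simp add: matrix_vector_mul_assoc transition_matrix_cocycle[OF assms(1,3)] transition_matrix_id[OF assms(3)])
    moreover have "analytic_vec \<gamma>"
    proof -
      have "analytic_mat (\<lambda>t. transpose (\<Phi> t 0))"
        using analytic_transition_matrix[OF assms(1,3)] by (simp add: analytic_mat_def transpose_def)
      then show ?thesis
        unfolding \<gamma>_def by (intro analytic_matrix_vector_mult c)
    qed
    moreover have "\<forall>x. (\<forall>t. x \<bullet> \<gamma> t = 0) \<longrightarrow> x = 0"
    proof (intro allI impI)
      fix x assume x: "\<forall>t. x \<bullet> \<gamma> t = 0"
      obtain t1 where "observable_on \<Phi> c 0 t1"
        using obs unfolding observable_def by blast
      moreover have "\<forall>t\<in>{0..t1}. c t \<bullet> (\<Phi> t 0 *v x) = 0"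
        using x \<gamma>[of _ x] by (simp add: inner_commute)
      ultimately show "x = 0"
        unfolding observable_on_def by blast
    qed
    ultimately have "countable {\<delta>. \<not> unif_nullifiable (\<lambda>_. mat 1)
        (\<lambda>j. B (of_int (j + 1) * \<delta>) - B (of_int j * \<delta>)) (\<lambda>j. \<gamma> (of_int j * \<delta>))}"
      using \<tau> by (intro countable_not_nullifiable_drift_free[OF \<beta> \<beta>_indep _ _ B, of \<gamma> \<tau>]) auto
    then show ?thesis
      using sample_nullifiable_drift_free[OF assms(1,3,2), of B _ c] B unfolding \<beta>_def \<gamma>_def by blast
  qed
  ultimately show ?thesis
    by (intro exI[of _ S]) (auto simp: S_def)
qed

end
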